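(* Let $(\mathbf{x},Y)$ be a random observation from the model with likelihood $\eta_1(\mathbf{x})\,\eta_2(Y,\boldsymbol{\beta}^{\mathrm T}\mathbf{x})$, where $\mathbf{x}\in\mathbb{R}^p$, $Y\in\mathbb{R}$, $\boldsymbol{\beta}=(\mathbf{I}_d,\boldsymbol{\beta}_l^{\mathrm T})^{\mathrm T}$ is a $p\times d$ matrix with $d<p$ and $\boldsymbol{\beta}_l\in\mathbb{R}^{(p-d)\times d}$ arbitrary, $\eta_1$ (the p.m.f./p.d.f., or mixture, of $\mathbf{x}$) and $\eta_2$ (the conditional p.m.f./p.d.f. of $Y$ given $\mathbf{x}$, depending on $\mathbf{x}$ only through $\boldsymbol{\beta}^{\mathrm T}\mathbf{x}$) are unknown infinite-dimensional nuisance parameters, and $\mathrm{vecl}(\boldsymbol{\beta})\in\mathbb{R}^{p_t}$, $p_t=(p-d)d$, is the parameter of interest. Let $\mathbf{S}_\beta=\partial\log\{\eta_1(\mathbf{x})\eta_2(Y,\boldsymbol{\beta}^{\mathrm T}\mathbf{x})\}/\partial\,\mathrm{vecl}(\boldsymbol{\beta})$ be the score vector, assumed square-integrable, and let $\Lambda$ be the nuisance tangent space. Then the efficient score $\mathbf{S}_{\mathrm{eff}}=\Pi(\mathbf{S}_\beta\mid\Lambda^\perp)$, the orthogonal projection of $\mathbf{S}_\beta$ onto $\Lambda^{\perp}$, is $$\mathbf{S}_{\mathrm{eff}}(Y,\mathbf{x},\boldsymbol{\beta}^{\mathrm T}\mathbf{x},\eta_2)=\mathrm{vecl}\left[\{\mathbf{x}-E(\mathbf{x}\mid\boldsymbol{\beta}^{\mathrm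 T}\mathbf{x})\}\frac{\partial\log\{\eta_2(Y,\boldsymbol{\beta}^{\mathrm T}\mathbf{x})\}}{\partial(\mathbf{x}^{\mathrm T}\boldsymbol{\beta})}\right].$$
   Context: For a $p\times d$ matrix $\mathbf{M}$, $\mathrm{vecl}(\mathbf{M})\in\mathbb{R}^{(p-d)d}$ is the vector obtained by concatenating the columns of the lower $(p-d)\times d$ submatrix of $\mathbf{M}$. The derivative $\partial/\partial(\mathbf{x}^{\mathrm T}\boldsymbol{\beta})$ is a $1\times d$ row vector (gradient of $\log\eta_2(Y,\mathbf{u})$ in $\mathbf{u}$, written as a row, evaluated at $\mathbf{u}=\boldsymbol{\beta}^{\mathrm T}\mathbf{x}$), so that the bracketed expression is a $p\times d$ matrix. Standing assumptions: $E(\mathbf{x})=\mathbf{0}$, $\mathrm{cov}(\mathbf{x})=\mathbf{I}_p$; there is no vector $\boldsymbol{\alpha}$ outside the column space of $\boldsymbol{\beta}$ such that $\boldsymbol{\alpha}^{\mathrm T}\mathbf{x}$ is a deterministic function of $\boldsymbol{\beta}^{\mathrm T}\mathbf{x}$. The ambient Hilbert space consists of mean-zero, finite-variance, $\mathbb{R}^{p_t}$-valued functions of $(Y,\mathbf{x})$, with inner product given by covariance, $\langle \mathbf{f},\mathbf{g}\rangle=E(\mathbf{f}^{\mathrm T}\mathbf{g})$, all expectations being taken under the true distribution. The nuisance tangent space is $\Lambda=\Lambda_1\oplus\Lambda_2$ (orthogonal sum), where $$\Lambda_1=\{\mathbf{f}(\mathbf{x}): E(\mathbf{f})=\mathbf{0}\},\qquad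 \Lambda_2=\{\mathbf{f}(Y,\boldsymbol{\beta}^{\mathrm T}\mathbf{x}): E(\mathbf{f}\mid\mathbf{x})=E(\mathbf{f}\mid\boldsymbol{\beta}^{\mathrm T}\mathbf{x})=\mathbf{0}\}.$$ $\Lambda^\perp$ denotes its orthogonal complement in the Hilbert space.
   Formalization: Added assumption: for almost every x, the integral of η₂(y,u) over y may be differentiated in u under the integral sign at u=βᵀx (so the score has conditional mean zero given x); without it the formula fails, e.g. for η₂(y,u)=exp(-(y-u)) on y>u. *)

theory Defs
  imports "HOL-Probability.Probability"
begin

text \<open>
  The dimension \<open>p = d + (p - d)\<close> is encoded by the index type \<open>'d + 'm\<close>, so
  \<open>d = CARD('d) \<ge> 1\<close> and \<open>p - d = CARD('m) \<ge> 1\<close>. A \<open>p \<times> d\<close> matrix has type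
  \<open>real^'d^('d + 'm)\<close>; rows \<open>Inl _\<close> form the upper \<open>d \<times> d\<close> block, rows \<open>Inr _\<close> the lower
  \<open>(p - d) \<times> d\<close> block. Vectors of length \<open>(p - d) d\<close> are indexed by pairs (column, row),
  which corresponds to concatenating columns.
\<close>

definition vecl :: "real^'d^('d::finite + 'm::finite) \<Rightarrow> real^('d \<times> 'm)" where
  "vecl A = (\<chi> k. A $ Inr (snd k) $ fst k)"

definition unvecl :: "real^('d::finite \<times> 'm::finite) \<Rightarrow> real^'d^'m" where
  "unvecl t = (\<chi> l j. t $ (j, l))"

definition beta_mat :: "real^'d^'m \<Rightarrow> real^'d^('d::finite + 'm::finite)" where
  "beta_mat Bl = (\<chi> i. case i of Inl k \<Rightarrow> mat 1 $ k | Inr l \<Rightarrow> Bl $ l)"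

lemma vecl_beta_mat_unvecl: "vecl (beta_mat (unvecl t)) = t"
  by (simp add: vecl_def beta_mat_def unvecl_def vec_eq_iff)

lemma unvecl_vecl_beta_mat: "unvecl (vecl (beta_mat Bl)) = Bl"
  by (simp add: vecl_def beta_mat_def unvecl_def vec_eq_iff)

definition outer :: "real^'n \<Rightarrow> real^'k \<Rightarrow> real^'k^'n" where
  "outer a b = (\<chi> i j. a $ i * b $ j)"

definition gradient :: "(real^'n \<Rightarrow> real) \<Rightarrow> real^'n \<Rightarrow> real^'n" where
  "gradient f u = (\<chi> j. frechet_derivative f (at u) (axis j 1))"

text \<open>
  An observation is a pair \<open>(y, x)\<close>. Its law has density \<open>eta1 x * eta2 y (B\<^sup>T x)\<close> with respect to
  the product of two dominating measures; counting, Lebesgue and mixed measures are all allowed.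
  The law is completed because elements of the Hilbert space are identified when they agree
  almost surely, and the score is only determined almost surely.
\<close>

definition obs_law ::
  "real measure \<Rightarrow> (real^'p) measure \<Rightarrow> (real^'p \<Rightarrow> real) \<Rightarrow> (real \<Rightarrow> real^'d \<Rightarrow> real)
    \<Rightarrow> real^'d^'p \<Rightarrow> (real \<times> (real^'p)) measure" where
  "obs_law nu mu eta1 eta2 B =
     completion (density (nu \<Otimes>\<^sub>M mu)
       (\<lambda>(y, x). ennreal (eta1 x * eta2 y (transpose B *v x))))"

definition score ::
  "(real^('d::finite + 'm::finite) \<Rightarrow> real) \<Rightarrow> (real \<Rightarrow> real^'d \<Rightarrow> real) \<Rightarrow> real^'d^'m
    \<Rightarrow> real \<times> (real^('d + 'm)) \<Rightarrow> real^('d \<times> 'm)" where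
  "score eta1 eta2 Bl = (\<lambda>(y, x).
     gradient (\<lambda>t. ln (eta1 x * eta2 y (transpose (beta_mat (unvecl t)) *v x)))
       (vecl (beta_mat Bl)))"

text \<open>
  Interchange of \<open>\<partial>/\<partial>u\<close> and \<open>\<integral> \<dots> d\<nu>(y)\<close> at the point \<open>u\<close>. Integrability has to be required
  explicitly, since the integral of a non-integrable function is \<open>0\<close> by convention.
\<close>

definition diff_under_integral ::
  "real measure \<Rightarrow> (real \<Rightarrow> real^'d \<Rightarrow> real) \<Rightarrow> real^'d \<Rightarrow> bool" where
  "diff_under_integral nu eta u \<longleftrightarrow>
     (\<exists>D. (AE y in nu. (eta y has_derivative D y) (at u)) \<and>
          (\<forall>h. integrable nu (\<lambda>y. D y h)) \<and>
          ((\<lambda>v. \<integral>y. eta y v \<partial>nu) has_derivative (\<lambda>h. \<integral>y. D y h \<partial>nu)) (at u))"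

definition cond_exp_given ::
  "'a measure \<Rightarrow> ('a \<Rightarrow> 'b::topological_space) \<Rightarrow> ('a \<Rightarrow> real^'k) \<Rightarrow> 'a \<Rightarrow> real^'k" where
  "cond_exp_given P T f =
     (\<lambda>w. \<chi> i. real_cond_exp P (vimage_algebra (space P) T borel) (\<lambda>w'. f w' $ i) w)"

definition hilbert_space :: "'a measure \<Rightarrow> ('a \<Rightarrow> real^'k) set" where
  "hilbert_space P =
     {f \<in> borel_measurable P. integrable P (\<lambda>w. (norm (f w))\<^sup>2) \<and> (\<integral>w. f w \<partial>P) = 0}"

definition cov_inner :: "'a measure \<Rightarrow> ('a \<Rightarrow> real^'k) \<Rightarrow> ('a \<Rightarrow> real^'k) \<Rightarrow> real" where
  "cov_inner P f g = (\<integral>w. f w \<bullet> g w \<partial>P)"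

definition tangent1 ::
  "(real \<times> (real^'p)) measure \<Rightarrow> (real \<times> (real^'p) \<Rightarrow> real^'k) set" where
  "tangent1 P =
     {f \<in> hilbert_space P. \<exists>h \<in> borel_measurable borel. AE (y, x) in P. f (y, x) = h x}"

definition tangent2 ::
  "(real \<times> (real^'p)) measure \<Rightarrow> real^'d^'p \<Rightarrow> (real \<times> (real^'p) \<Rightarrow> real^'k) set" where
  "tangent2 P B =
     {f \<in> hilbert_space P.
        (\<exists>h \<in> borel_measurable borel. AE (y, x) in P. f (y, x) = h (y, transpose B *v x)) \<and>
        (AE w in P. cond_exp_given P snd f w = 0) \<and>
        (AE w in P. cond_exp_given P (\<lambda>(y, x). transpose B *v x) f w = 0)}"

definition nuisance_tangent ::
  "(real \<times> (real^'p)) measure \<Rightarrow> real^'d^'p \<Rightarrow> (real \<times> (real^'p) \<Rightarrow> real^'k) set" where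
  "nuisance_tangent P B = {\<lambda>w. f1 w + f2 w | f1 f2. f1 \<in> tangent1 P \<and> f2 \<in> tangent2 P B}"

definition orth_compl :: "'a measure \<Rightarrow> ('a \<Rightarrow> real^'k) set \<Rightarrow> ('a \<Rightarrow> real^'k) set" where
  "orth_compl P L = {g \<in> hilbert_space P. \<forall>f \<in> L. cov_inner P f g = 0}"

text \<open>\<open>s\<close> is a version of the orthogonal projection of \<open>S\<close> onto the subspace \<open>V\<close>.\<close>

definition is_projection ::
  "'a measure \<Rightarrow> ('a \<Rightarrow> real^'k) \<Rightarrow> ('a \<Rightarrow> real^'k) set \<Rightarrow> ('a \<Rightarrow> real^'k) \<Rightarrow> bool" where
  "is_projection P S V s \<longleftrightarrow>
     S \<in> hilbert_space P \<and> s \<in> V \<and> (\<forall>g \<in> V. cov_inner P (\<lambda>w. S w - s w) g = 0)"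

end

theory Submission
  imports Defs
begin

text \<open>
  Write \<open>u = \<beta>\<^sup>T x\<close> and let \<open>G = \<partial> log \<eta>\<^sub>2(Y, u) / \<partial>u\<close>, so that the score has the components \<open>x\<^sub>l G\<^sub>j\<close>.
  As \<open>Y\<close> and \<open>x\<close> are conditionally independent given \<open>u\<close>, \<open>E(x | Y, u) = E(x | u)\<close>, hence
  \<open>R = E(S\<^sub>\<beta> | Y, u)\<close> has the components \<open>E(x\<^sub>l | u) G\<^sub>j\<close>. This shows that they are square integrable
  although \<open>G\<close> itself need not be, and that \<open>S\<^sub>\<beta> - R\<close> is orthogonal to all functions of \<open>(Y, u)\<close>, in
  particular to \<open>\<Lambda>\<^sub>2\<close>. Differentiating \<open>\<integral> \<eta>\<^sub>2(y, u) d\<nu>(y) = 1\<close> gives \<open>E(G | x) = 0\<close>, whence \<open>R \<in> \<Lambda>\<^sub>2\<close> and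
  \<open>S\<^sub>\<beta> - R\<close> is orthogonal to \<open>\<Lambda>\<^sub>1\<close>. So \<open>S\<^sub>\<beta> - R\<close> is the projection of \<open>S\<^sub>\<beta>\<close> onto the orthogonal complement of \<open>\<Lambda>\<close>.
\<close>

subsection \<open>Square-integrable functions and projections\<close>

text \<open>Doob-Dynkin factorization. It holds for indicators because the sets of the vimage
  algebra are preimages, and it survives sums, multiples and limits. It later turns E(x_l | u) into
  a genuine Borel function of u.\<close>

lemma vimage_algebra_factor_real:
  fixes f :: "'a \<Rightarrow> real"
  assumes T: "T \<in> X \<rightarrow> space M"
    and f: "f \<in> borel_measurable (vimage_algebra X T M)"
  obtains h where "h \<in> borel_measurable M" "\<And>w. w \<in> X \<Longrightarrow> f w = h (T w)"
proof -
  let ?V = "vimage_algebra X T M"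
  have nonneg: "\<exists>h\<in>borel_measurable M. \<forall>w\<in>X. g w = h (T w)"
    if "g \<in> borel_measurable ?V" "\<And>w. 0 \<le> g w" for g :: "'a \<Rightarrow> real"
    using that
  proof (induction rule: borel_measurable_induct_real)
    case (set A)
    then obtain A' where A': "A' \<in> sets M" "A = T -` A' \<inter> X"
      using sets_vimage_algebra2[OF T] by auto
    show ?case
      using A' by (intro bexI[of _ "indicator A'"]) (auto simp: indicator_def)
  next
    case (mult u c)
    from mult.IH obtain h where "h \<in> borel_measurable M" "\<forall>w\<in>X. u w = h (T w)" by blast
    then show ?case
      by (intro bexI[of _ "\<lambda>z. c * h z"]) auto
  next
    case (add u v)
    from add.IH obtain h h' where "h \<in> borel_measurable M" "\<forall>w\<in>X. u w = h (T w)"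
      "h' \<in> borel_measurable M" "\<forall>w\<in>X. v w = h' (T w)" by blast
    then show ?case
      by (intro bexI[of _ "\<lambda>z. h' z + h z"]) auto
  next
    case (seq U)
    from seq.IH obtain H where H: "\<And>i. H i \<in> borel_measurable M" "\<And>i w. w \<in> X \<Longrightarrow> U i w = H i (T w)"
      by metis
    have "(\<lambda>i. H i (T w)) \<longlonglongrightarrow> g w" if "w \<in> X" for w
      using seq.hyps(4)[of w] that H(2) by simp
    \<comment> \<open>Off the image of \<open>X\<close> under \<open>T\<close> the sequence
      \<open>H i\<close> may diverge; \<open>lim\<close> still has some value there, and the limit
      function stays measurable.\<close>
    then have "\<forall>w\<in>X. g w = lim (\<lambda>i. H i (T w))"
      by (auto intro!: limI[symmetric])
    moreover have "(\<lambda>z. lim (\<lambda>i. H i z)) \<in> borel_measurable M"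
      using H(1) by (rule borel_measurable_lim_metric)
    ultimately show ?case by (intro bexI[of _ "\<lambda>z. lim (\<lambda>i. H i z)"]) auto
  qed
  note [measurable] = f
  have "(\<lambda>w. max 0 (f w)) \<in> borel_measurable ?V" by measurable
  from nonneg[OF this] obtain h where h: "h \<in> borel_measurable M"
    "\<And>w. w \<in> X \<Longrightarrow> max 0 (f w) = h (T w)" by auto
  have "(\<lambda>w. max 0 (- f w)) \<in> borel_measurable ?V" by measurable
  from nonneg[OF this] obtain h' where h': "h' \<in> borel_measurable M"
    "\<And>w. w \<in> X \<Longrightarrow> max 0 (- f w) = h' (T w)" by auto
  show ?thesis
  proof (rule that)
    show "(\<lambda>z. h z - h' z) \<in> borel_measurable M" using h h' by simp
    show "f w = h (T w) - h' (T w)" if "w \<in> X" for w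
      using h(2)[OF that] h'(2)[OF that] by (simp add: max_def split: if_splits)
  qed
qed

text \<open>Preimages under \<open>f\<close> and \<open>g\<close> differ by a null set, which
  completeness makes measurable. This serves the score, which is only known to agree almost surely
  with a Borel function.\<close>

lemma (in complete_measure) measurable_cong_AE:
  assumes g: "g \<in> M \<rightarrow>\<^sub>M N" and f: "f \<in> space M \<rightarrow> space N" and eq: "AE w in M. f w = g w"
  shows "f \<in> M \<rightarrow>\<^sub>M N"
proof (rule measurableI)
  fix A assume A: "A \<in> sets N"
  have "AE w in M. w \<in> g -` A \<inter> space M \<longleftrightarrow> w \<in> f -` A \<inter> space M"
    using eq by eventually_elim auto
  then show "f -` A \<inter> space M \<in> sets M"
    by (rule in_sets_AE) (use g A in \<open>auto intro: measurable_sets\<close>)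
qed (use f in auto)

lemma integrable_inner_of_square:
  fixes f g :: "'a \<Rightarrow> 'b::{real_inner, second_countable_topology}"
  assumes [measurable]: "f \<in> borel_measurable M" "g \<in> borel_measurable M"
    and "integrable M (\<lambda>w. (norm (f w))\<^sup>2)" "integrable M (\<lambda>w. (norm (g w))\<^sup>2)"
  shows "integrable M (\<lambda>w. f w \<bullet> g w)"
proof (rule Bochner_Integration.integrable_bound)
  show "integrable M (\<lambda>w. (norm (f w))\<^sup>2 + (norm (g w))\<^sup>2)"
    using assms by simp
  have "\<bar>f w \<bullet> g w\<bar> \<le> (norm (f w))\<^sup>2 + (norm (g w))\<^sup>2" for w
  proof -
    have "0 \<le> norm (f w) * norm (g w)" by simp
    then show ?thesis
      using Cauchy_Schwarz_ineq2[of "f w" "g w"] sum_squares_bound[of "norm (f w)" "norm (g w)"]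
      by linarith
  qed
  then show "AE w in M. norm (f w \<bullet> g w) \<le> norm ((norm (f w))\<^sup>2 + (norm (g w))\<^sup>2)"
    by simp
qed simp

lemma integrable_mult_of_square:
  fixes f g :: "'a \<Rightarrow> real"
  assumes "f \<in> borel_measurable M" "g \<in> borel_measurable M"
    and "integrable M (\<lambda>w. (f w)\<^sup>2)" "integrable M (\<lambda>w. (g w)\<^sup>2)"
  shows "integrable M (\<lambda>w. f w * g w)"
  using integrable_inner_of_square[of f M g] assms by simp

lemma integrable_square_diff:
  fixes f g :: "'a \<Rightarrow> 'b::{real_inner, second_countable_topology}"
  assumes [measurable]: "f \<in> borel_measurable M" "g \<in> borel_measurable M"
    and "integrable M (\<lambda>w. (norm (f w))\<^sup>2)" "integrable M (\<lambda>w. (norm (g w))\<^sup>2)"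
  shows "integrable M (\<lambda>w. (norm (f w - g w))\<^sup>2)"
proof -
  have "(\<lambda>w. (norm (f w - g w))\<^sup>2) = (\<lambda>w. (norm (f w))\<^sup>2 + (norm (g w))\<^sup>2 - 2 * (f w \<bullet> g w))"
    by (simp add: power2_norm_eq_inner inner_diff_left inner_diff_right inner_commute algebra_simps)
  then show ?thesis
    using assms integrable_inner_of_square[OF assms] by simp
qed

text \<open>Conditional Jensen inequality for the square. Through it the conditional mean of the
  score given (Y, u) inherits square integrability.\<close>

lemma (in finite_measure_subalgebra) integrable_square_real_cond_exp:
  assumes [measurable]: "f \<in> borel_measurable M" and f: "integrable M (\<lambda>w. (f w)\<^sup>2)"
  shows "integrable M (\<lambda>w. (real_cond_exp M F f w)\<^sup>2)"
proof -
  have "integrable M f" using square_integrable_imp_integrable[OF _ f] by simp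
  moreover have "convex_on UNIV (\<lambda>x::real. x\<^sup>2)"
    by (rule convex_power2)
  ultimately have "AE w in M. (real_cond_exp M F f w)\<^sup>2 \<le> real_cond_exp M F (\<lambda>w. (f w)\<^sup>2) w"
    using real_cond_exp_jensens_inequality(2)[of f UNIV _ _ "\<lambda>x. x\<^sup>2"] f by simp
  then show ?thesis
    by (intro Bochner_Integration.integrable_bound[OF real_cond_exp_int(1)[OF f]]) auto
qed

lemma component_square_le_norm_square: "(x $ i)\<^sup>2 \<le> (norm x)\<^sup>2" for x :: "real^'k"
  using component_le_norm_cart[of x i] by (metis abs_le_square_iff abs_norm_cancel)

lemma borel_measurable_vec_nth_comp:
  fixes h :: "'a \<Rightarrow> real^'k"
  assumes "h \<in> borel_measurable M"
  shows "(\<lambda>w. h w $ i) \<in> borel_measurable M"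
proof -
  have "(\<lambda>w. h w \<bullet> axis i 1) \<in> borel_measurable M"
    using assms by (intro borel_measurable_inner) auto
  then show ?thesis by (simp add: inner_axis)
qed

lemma borel_measurable_vecI:
  fixes f :: "'a \<Rightarrow> real^'k"
  assumes "\<And>i. (\<lambda>w. f w $ i) \<in> borel_measurable M"
  shows "f \<in> borel_measurable M"
  by (subst borel_measurable_euclidean_space) (use assms in \<open>auto simp: Basis_vec_def inner_axis\<close>)

lemma hilbert_space_memI:
  fixes f :: "'a \<Rightarrow> real^'k"
  assumes "prob_space P"
    and f: "\<And>i. (\<lambda>w. f w $ i) \<in> borel_measurable P" "\<And>i. integrable P (\<lambda>w. (f w $ i)\<^sup>2)"
    and 0: "\<And>i. (\<integral>w. f w $ i \<partial>P) = 0"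
  shows "f \<in> hilbert_space P"
proof -
  interpret prob_space P by fact
  have fm[measurable]: "f \<in> borel_measurable P"
    using f(1) by (rule borel_measurable_vecI)
  have sq: "integrable P (\<lambda>w. (norm (f w))\<^sup>2)"
    using f(2) unfolding power2_norm_eq_inner inner_vec_def by (simp add: power2_eq_square)
  then have "integrable P f"
    using square_integrable_imp_integrable[of "\<lambda>w. norm (f w)"] integrable_norm_cancel[OF _ fm] by simp
  then have "(\<integral>w. f w \<partial>P) $ i = (\<integral>w. f w $ i \<partial>P)" for i
    using integral_inner_left[of "axis i 1" P f] by (simp add: inner_axis)
  then show ?thesis
    using sq 0 by (simp add: hilbert_space_def vec_eq_iff)
qed

lemma hilbert_space_component:
  fixes f :: "'a \<Rightarrow> real^'k"
  assumes "f \<in> hilbert_space P"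
  shows "(\<lambda>w. f w $ i) \<in> borel_measurable P" "integrable P (\<lambda>w. (f w $ i)\<^sup>2)"
proof -
  have f: "f \<in> borel_measurable P" "integrable P (\<lambda>w. (norm (f w))\<^sup>2)"
    using assms by (auto simp: hilbert_space_def)
  show m: "(\<lambda>w. f w $ i) \<in> borel_measurable P"
    using f(1) by (rule borel_measurable_vec_nth_comp)
  show "integrable P (\<lambda>w. (f w $ i)\<^sup>2)"
    using m by (intro Bochner_Integration.integrable_bound[OF f(2)]) (auto simp: component_square_le_norm_square)
qed

lemma integrable_cov_inner:
  assumes "f \<in> hilbert_space P" "g \<in> hilbert_space P"
  shows "integrable P (\<lambda>w. f w \<bullet> g w)"
  by (rule integrable_inner_of_square) (use assms in \<open>simp_all add: hilbert_space_def\<close>)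

lemma cov_inner_eq_sum:
  fixes f g :: "'a \<Rightarrow> real^'k"
  assumes "f \<in> hilbert_space P" "g \<in> hilbert_space P"
  shows "cov_inner P f g = (\<Sum>i\<in>UNIV. \<integral>w. f w $ i * g w $ i \<partial>P)"
  unfolding cov_inner_def inner_vec_def inner_real_def
proof (rule Bochner_Integration.integral_sum)
  fix i
  show "integrable P (\<lambda>w. f w $ i * g w $ i)"
    by (rule integrable_mult_of_square) (simp_all add: assms hilbert_space_component)
qed

lemma integrable_hilbert_space:
  assumes "prob_space P" "f \<in> hilbert_space P"
  shows "integrable P f"
proof -
  interpret prob_space P by fact
  have f: "f \<in> borel_measurable P" "integrable P (\<lambda>w. (norm (f w))\<^sup>2)"
    using assms by (auto simp: hilbert_space_def)
  have "integrable P (\<lambda>w. norm (f w))"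
    by (rule square_integrable_imp_integrable) (use f in simp_all)
  then show ?thesis by (rule integrable_norm_cancel) (rule f(1))
qed

lemma hilbert_space_diff:
  assumes "prob_space P" "f \<in> hilbert_space P" "g \<in> hilbert_space P"
  shows "(\<lambda>w. f w - g w) \<in> hilbert_space P"
proof -
  have "integrable P (\<lambda>w. (norm (f w - g w))\<^sup>2)"
    by (rule integrable_square_diff) (use assms(2,3) in \<open>simp_all add: hilbert_space_def\<close>)
  moreover have "(\<integral>w. f w - g w \<partial>P) = (\<integral>w. f w \<partial>P) - (\<integral>w. g w \<partial>P)"
    using assms by (intro Bochner_Integration.integral_diff integrable_hilbert_space)
  ultimately show ?thesis
    using assms(2,3) by (auto simp: hilbert_space_def)
qed

lemma hilbert_space_add:
  assumes "prob_space P" "f \<in> hilbert_space P" "g \<in> hilbert_space P"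
  shows "(\<lambda>w. f w + g w) \<in> hilbert_space P"
proof -
  have "(\<lambda>_. 0) \<in> hilbert_space P" by (simp add: hilbert_space_def)
  then have "(\<lambda>w. f w - (0 - g w)) \<in> hilbert_space P"
    using assms by (intro hilbert_space_diff)
  then show ?thesis by simp
qed

text \<open>Members of \<open>hilbert_space\<close> have integrable inner products, so the integral
  may be split; this is why \<open>L\<close> has to lie in that space.\<close>

lemma orth_compl_diff:
  assumes "prob_space P" "L \<subseteq> hilbert_space P" "f \<in> orth_compl P L" "g \<in> orth_compl P L"
  shows "(\<lambda>w. f w - g w) \<in> orth_compl P L"
proof -
  have "cov_inner P h (\<lambda>w. f w - g w) = cov_inner P h f - cov_inner P h g" if "h \<in> L" for h
    unfolding cov_inner_def inner_diff_right
    using assms that by (intro Bochner_Integration.integral_diff integrable_cov_inner) (auto simp: orth_compl_def)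
  then show ?thesis
    using assms hilbert_space_diff[of P f g] by (auto simp: orth_compl_def)
qed

lemma cov_inner_cong_AE:
  assumes "complete_measure P" "AE w in P. f w = f' w"
    and "g \<in> borel_measurable P" "f \<in> borel_measurable P"
  shows "cov_inner P f g = cov_inner P f' g" "cov_inner P g f = cov_inner P g f'"
proof -
  interpret complete_measure P by fact
  have [measurable]: "f' \<in> borel_measurable P"
    by (rule measurable_cong_AE[OF assms(4)]) (use assms(2) in \<open>auto elim: eventually_mono\<close>)
  note [measurable] = assms(3,4)
  show "cov_inner P f g = cov_inner P f' g"
    unfolding cov_inner_def by (rule integral_cong_AE) (use assms(2) in auto)
  show "cov_inner P g f = cov_inner P g f'"
    unfolding cov_inner_def by (rule integral_cong_AE) (use assms(2) in auto)
qed

lemma hilbert_space_cong_AE: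
  assumes "complete_measure P" "AE w in P. f w = f' w" "f \<in> hilbert_space P"
  shows "f' \<in> hilbert_space P"
proof -
  interpret complete_measure P by fact
  have f[measurable]: "f \<in> borel_measurable P" and
    sq: "integrable P (\<lambda>w. (norm (f w))\<^sup>2)" and 0: "(\<integral>w. f w \<partial>P) = 0"
    using assms(3) by (auto simp: hilbert_space_def)
  have f'[measurable]: "f' \<in> borel_measurable P"
    by (rule measurable_cong_AE[OF f]) (use assms(2) in \<open>auto elim: eventually_mono\<close>)
  have "integrable P (\<lambda>w. (norm (f' w))\<^sup>2)"
    by (rule integrable_cong_AE_imp[OF sq]) (use assms(2) in \<open>auto elim: eventually_mono\<close>)
  moreover have "(\<integral>w. f' w \<partial>P) = (\<integral>w. f w \<partial>P)"
    by (rule integral_cong_AE) (use assms(2) in \<open>auto elim: eventually_mono\<close>)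
  ultimately show ?thesis
    using 0 by (simp add: hilbert_space_def)
qed

text \<open>Two versions differ by an element of the complement that is orthogonal to itself, hence
  null. Conversely, a change on a null set preserves measurability by completeness, and all inner
  products with it.\<close>

lemma is_projection_orth_compl_iff:
  assumes P: "complete_measure P" "prob_space P" and L: "L \<subseteq> hilbert_space P"
    and s: "is_projection P S (orth_compl P L) s"
  shows "is_projection P S (orth_compl P L) s' \<longleftrightarrow> (AE w in P. s' w = s w)"
proof
  have S: "S \<in> hilbert_space P" and sV: "s \<in> orth_compl P L"
    and ort: "\<And>g. g \<in> orth_compl P L \<Longrightarrow> cov_inner P (\<lambda>w. S w - s w) g = 0"
    using s by (auto simp: is_projection_def)
  then have sH: "s \<in> hilbert_space P" by (simp add: orth_compl_def)
  have H: "f \<in> borel_measurable P" if "f \<in> hilbert_space P" for f :: "'a \<Rightarrow> real^'b"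
    using that by (simp add: hilbert_space_def)
  {
    assume s': "is_projection P S (orth_compl P L) s'"
    then have s'V: "s' \<in> orth_compl P L" and s'H: "s' \<in> hilbert_space P"
      by (auto simp: is_projection_def orth_compl_def)
    define g where "g = (\<lambda>w. s' w - s w)"
    have gV: "g \<in> orth_compl P L"
      unfolding g_def using P(2) L s'V sV by (rule orth_compl_diff)
    then have gH: "g \<in> hilbert_space P" by (simp add: orth_compl_def)
    \<comment> \<open>Both residuals are orthogonal to \<open>g\<close>, and their difference is
      \<open>g\<close> itself, so subtracting yields the squared norm of \<open>g\<close>.\<close>
    have "cov_inner P (\<lambda>w. S w - s w) g - cov_inner P (\<lambda>w. S w - s' w) g = 0"
      using ort[OF gV] s' gV by (simp add: is_projection_def)
    moreover have "cov_inner P (\<lambda>w. S w - s w) g - cov_inner P (\<lambda>w. S w - s' w) g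
        = (\<integral>w. (S w - s w) \<bullet> g w - (S w - s' w) \<bullet> g w \<partial>P)"
      unfolding cov_inner_def
      using P(2) gH S sH s'H
      by (intro Bochner_Integration.integral_diff[symmetric] integrable_cov_inner hilbert_space_diff)
    moreover have "(\<lambda>w. (S w - s w) \<bullet> g w - (S w - s' w) \<bullet> g w) = (\<lambda>w. (norm (g w))\<^sup>2)"
      by (simp add: g_def power2_norm_eq_inner inner_diff_left inner_diff_right algebra_simps)
    ultimately have "(\<integral>w. (norm (g w))\<^sup>2 \<partial>P) = 0" by simp
    then have "AE w in P. (norm (g w))\<^sup>2 = 0"
      using gH by (subst (asm) integral_nonneg_eq_0_iff_AE) (auto simp: hilbert_space_def)
    then show "AE w in P. s' w = s w" by (simp add: g_def)
  }
  {
    assume "AE w in P. s' w = s w"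
    then have eq: "AE w in P. s w = s' w" by (auto elim: eventually_mono)
    have "s' \<in> hilbert_space P"
      using P(1) eq sH by (rule hilbert_space_cong_AE)
    moreover have "cov_inner P f s' = 0" if "f \<in> L" for f
      using cov_inner_cong_AE(2)[OF P(1) eq H H[OF sH], of f] that L sV by (auto simp: orth_compl_def)
    moreover have "cov_inner P (\<lambda>w. S w - s' w) g = 0" if g: "g \<in> orth_compl P L" for g
    proof -
      have "AE w in P. S w - s w = S w - s' w" using eq by eventually_elim simp
      then show ?thesis
        using cov_inner_cong_AE(1)[OF P(1), of "\<lambda>w. S w - s w" "\<lambda>w. S w - s' w" g]
          ort[OF g] g H[OF S] H[OF sH] H by (auto simp: orth_compl_def)
    qed
    ultimately show "is_projection P S (orth_compl P L) s'"
      using S by (simp add: is_projection_def orth_compl_def)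
  }
qed

lemma nuisance_tangent_subset_hilbert_space:
  assumes "prob_space P"
  shows "nuisance_tangent P B \<subseteq> hilbert_space P"
  using hilbert_space_add[OF assms] by (auto simp: nuisance_tangent_def tangent1_def tangent2_def)

lemma cond_exp_given_eq_zero:
  fixes f :: "'a \<Rightarrow> real^'k"
  assumes "\<And>i. AE w in P. real_cond_exp P (vimage_algebra (space P) T borel) (\<lambda>w. f w $ i) w = 0"
  shows "AE w in P. cond_exp_given P T f w = 0"
proof -
  have "AE w in P. \<forall>i\<in>UNIV. real_cond_exp P (vimage_algebra (space P) T borel) (\<lambda>w. f w $ i) w = 0"
    by (rule AE_finite_allI) (use assms in auto)
  then show ?thesis
    by eventually_elim (simp add: cond_exp_given_def vec_eq_iff)
qed

subsection \<open>Conditional independence given the index\<close>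

text \<open>The measure-theoretic core, with an arbitrary Borel map \<open>T\<close> in place of the
  linear index: \<open>e1\<close> is the density of x and \<open>e2\<close> the conditional density
  of Y. Derivatives are kept out of it.\<close>

locale index_model =
  nu: sigma_finite_measure nu + mu: sigma_finite_measure mu
  for nu :: "'y::second_countable_topology measure"
    and mu :: "'x::second_countable_topology measure" +
  fixes e1 :: "'x \<Rightarrow> real" and e2 :: "'y \<Rightarrow> 'u::second_countable_topology \<Rightarrow> real" and T :: "'x \<Rightarrow> 'u"
  assumes sets_nu[measurable_cong]: "sets nu = sets borel"
    and sets_mu[measurable_cong]: "sets mu = sets borel"
    and e1[measurable]: "e1 \<in> borel_measurable borel"
    and e1_nonneg: "\<And>x. 0 \<le> e1 x"
    and e1_total: "(\<integral>\<^sup>+x. ennreal (e1 x) \<partial>mu) = 1"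
    and e2[measurable]: "(\<lambda>(y, u). e2 y u) \<in> borel_measurable (borel \<Otimes>\<^sub>M borel)"
    and e2_nonneg: "\<And>y u. 0 \<le> e2 y u"
    and e2_total: "\<And>u. (\<integral>\<^sup>+y. ennreal (e2 y u) \<partial>nu) = 1"
    and T[measurable]: "T \<in> borel_measurable borel"
begin

sublocale pair_sigma_finite nu mu ..

section \<open>The observation law and iterated integrals\<close>

definition P :: "('y \<times> 'x) measure" where
  "P = completion (density (nu \<Otimes>\<^sub>M mu) (\<lambda>(y, x). ennreal (e1 x * e2 y (T x))))"

lemma space_nu: "space nu = UNIV" and space_mu: "space mu = UNIV"
  using sets_eq_imp_space_eq[OF sets_nu] sets_eq_imp_space_eq[OF sets_mu] by auto

lemma sets_nu_mu: "sets (nu \<Otimes>\<^sub>M mu) = sets (borel \<Otimes>\<^sub>M borel)"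
  by (intro sets_pair_measure_cong sets_nu sets_mu)

lemma measurable_nu_mu: "measurable (nu \<Otimes>\<^sub>M mu) N = measurable (borel \<Otimes>\<^sub>M borel) N"
  by (intro measurable_cong_sets sets_nu_mu refl)

lemma space_P[simp]: "space P = UNIV"
  by (simp add: P_def space_pair_measure space_nu space_mu)

lemma measurable_e2_comp[measurable (raw)]:
  assumes "f \<in> borel_measurable M" "g \<in> borel_measurable M"
  shows "(\<lambda>w. e2 (f w) (g w)) \<in> borel_measurable M"
  using measurable_compose[OF measurable_Pair[OF assms] e2] by simp

lemma borel_measurable_likelihood[measurable]:
  "(\<lambda>(y, x). e1 x * e2 y (T x)) \<in> borel_measurable (nu \<Otimes>\<^sub>M mu)"
  unfolding measurable_nu_mu split_beta' by measurable

lemma borel_measurable_likelihood'[measurable]: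
  "(\<lambda>(y, x). ennreal (e1 x * e2 y (T x))) \<in> borel_measurable (nu \<Otimes>\<^sub>M mu)"
  using borel_measurable_likelihood by (simp add: split_beta')

lemma measurable_P:
  assumes "f \<in> measurable (borel \<Otimes>\<^sub>M borel) N"
  shows "f \<in> measurable P N"
  unfolding P_def using assms by (intro measurable_completion) (simp add: measurable_nu_mu)

lemma complete_P: "complete_measure P"
  unfolding P_def by (rule completion.complete_measure_axioms)

text \<open>Tonelli with \<open>y\<close> integrated inside, so that factors in \<open>x\<close>
  alone leave the inner integral and \<open>e2_total\<close> applies to what remains.\<close>

lemma nn_integral_P:
  assumes [measurable]: "F \<in> borel_measurable (borel \<Otimes>\<^sub>M borel)"
  shows "(\<integral>\<^sup>+w. F w \<partial>P) = (\<integral>\<^sup>+x. ennreal (e1 x) * (\<integral>\<^sup>+y. ennreal (e2 y (T x)) * F (y, x) \<partial>nu) \<partial>mu)"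
proof -
  have "(\<integral>\<^sup>+w. F w \<partial>P) = (\<integral>\<^sup>+w. (case w of (y, x) \<Rightarrow> ennreal (e1 x * e2 y (T x))) * F w \<partial>(nu \<Otimes>\<^sub>M mu))"
    unfolding P_def nn_integral_completion
    by (rule nn_integral_density) (simp_all add: assms measurable_nu_mu borel_measurable_likelihood'[unfolded measurable_nu_mu])
  also have "\<dots> = (\<integral>\<^sup>+x. \<integral>\<^sup>+y. ennreal (e1 x * e2 y (T x)) * F (y, x) \<partial>nu \<partial>mu)"
    by (subst nn_integral_snd[symmetric]) (auto simp: split_beta')
  also have "\<dots> = (\<integral>\<^sup>+x. ennreal (e1 x) * (\<integral>\<^sup>+y. ennreal (e2 y (T x)) * F (y, x) \<partial>nu) \<partial>mu)"
    by (subst nn_integral_cmult[symmetric]) (auto simp: ennreal_mult' e1_nonneg mult.assoc)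
  finally show ?thesis .
qed

lemma prob_space_P: "prob_space P"
proof (rule prob_spaceI)
  have "emeasure P (space P) = (\<integral>\<^sup>+w. 1 \<partial>P)" by simp
  also have "\<dots> = 1" by (subst nn_integral_P) (simp_all add: e2_total e1_total)
  finally show "emeasure P (space P) = 1" .
qed

sublocale P: prob_space P by (rule prob_space_P)
sublocale P: complete_measure P by (rule complete_P)

lemma AE_P_iff:
  "(AE w in P. Q w) \<longleftrightarrow> (AE (y, x) in nu \<Otimes>\<^sub>M mu. 0 < e1 x \<and> 0 < e2 y (T x) \<longrightarrow> Q (y, x))"
proof -
  have pos: "0 < e1 x * e2 y u \<longleftrightarrow> 0 < e1 x \<and> 0 < e2 y u" for x y u
    using e1_nonneg[of x] e2_nonneg[of y u] by (auto simp: zero_less_mult_iff)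
  show ?thesis
    unfolding P_def AE_completion_iff by (subst AE_density) (simp_all add: split_beta' pos borel_measurable_likelihood'[unfolded split_beta'])
qed

lemma AE_P_pos: "AE (y, x) in P. 0 < e1 x \<and> 0 < e2 y (T x)"
  unfolding AE_P_iff by (simp add: split_beta')

text \<open>The total mass 1 of \<open>e2\<close> at \<open>u\<close> prevents the set where it is
  positive from being null.\<close>

lemma AE_e2_pos_const:
  assumes "AE y in nu. 0 < e2 y u \<longrightarrow> Q"
  shows Q
proof (rule ccontr)
  assume "\<not> Q"
  have "AE y in nu. ennreal (e2 y u) = 0"
    using assms
  proof eventually_elim
    case (elim y)
    then show ?case using \<open>\<not> Q\<close> by (simp add: ennreal_eq_0_iff)
  qed
  then have "(\<integral>\<^sup>+y. ennreal (e2 y u) \<partial>nu) = 0"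
    by (subst nn_integral_0_iff_AE) simp_all
  then show False using e2_total[of u] by simp
qed

text \<open>Regularity of the model is given almost surely under the joint law, while centering is
  needed for almost every \<open>x\<close>. Fubini for null sets yields a statement in
  \<open>y\<close> for almost every \<open>x\<close>, and \<open>AE_e2_pos_const\<close> removes
  \<open>y\<close>.\<close>

lemma AE_P_snd:
  assumes "AE (y, x) in P. Q x"
  shows "AE x in mu. 0 < e1 x \<longrightarrow> Q x"
proof -
  \<comment> \<open>\<open>AE_pair\<close> slices along the first factor, so the factors are
    exchanged first.\<close>
  interpret Q: pair_sigma_finite mu nu ..
  have "AE w in distr (mu \<Otimes>\<^sub>M nu) (nu \<Otimes>\<^sub>M mu) (\<lambda>(x, y). (y, x)).
      0 < e1 (snd w) \<and> 0 < e2 (fst w) (T (snd w)) \<longrightarrow> Q (snd w)"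
    using assms unfolding AE_P_iff distr_pair_swap[symmetric] by (simp add: split_beta')
  then have "AE w in mu \<Otimes>\<^sub>M nu. 0 < e1 (fst w) \<and> 0 < e2 (snd w) (T (fst w)) \<longrightarrow> Q (fst w)"
    by (drule_tac AE_distrD[rotated]) (auto simp: split_beta')
  then have "AE x in mu. AE y in nu. 0 < e1 x \<and> 0 < e2 y (T x) \<longrightarrow> Q x"
    by (drule_tac Q.AE_pair) simp
  then show ?thesis
  proof (rule AE_mp, intro AE_I2 impI)
    fix x assume x: "AE y in nu. 0 < e1 x \<and> 0 < e2 y (T x) \<longrightarrow> Q x" "0 < e1 x"
    then have "AE y in nu. 0 < e2 y (T x) \<longrightarrow> Q x" by simp
    then show "Q x" by (rule AE_e2_pos_const)
  qed
qed

lemma integral_P: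
  fixes F :: "'y \<times> 'x \<Rightarrow> real"
  assumes [measurable]: "F \<in> borel_measurable (borel \<Otimes>\<^sub>M borel)" and F: "integrable P F"
  shows "(\<integral>w. F w \<partial>P) = (\<integral>x. e1 x * (\<integral>y. F (y, x) * e2 y (T x) \<partial>nu) \<partial>mu)"
proof -
  let ?d = "\<lambda>(y, x). e1 x * e2 y (T x)"
  have d: "AE w in nu \<Otimes>\<^sub>M mu. 0 \<le> ?d w" using e1_nonneg e2_nonneg by auto
  have Fm[measurable]: "F \<in> borel_measurable (nu \<Otimes>\<^sub>M mu)"
    by (simp add: measurable_nu_mu)
  have eq: "(\<lambda>(y, x). ennreal (e1 x * e2 y (T x))) = (\<lambda>w. ennreal (?d w))" by auto
  have "integrable (nu \<Otimes>\<^sub>M mu) (\<lambda>w. ?d w *\<^sub>R F w)"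
    using F d unfolding P_def eq by (subst (asm) integrable_completion) (auto simp: integrable_density)
  then have "integrable (nu \<Otimes>\<^sub>M mu) (\<lambda>(y, x). e1 x * e2 y (T x) * F (y, x))"
    by (simp add: split_beta')
  note int = integral_snd[OF this]
  have "(\<integral>w. F w \<partial>P) = (\<integral>w. ?d w *\<^sub>R F w \<partial>(nu \<Otimes>\<^sub>M mu))"
    unfolding P_def eq using d by (subst integral_completion) (auto simp: integral_density)
  also have "\<dots> = (\<integral>x. \<integral>y. e1 x * e2 y (T x) * F (y, x) \<partial>nu \<partial>mu)"
    using int by (simp add: split_beta')
  \<comment> \<open>The factor \<open>e1 x\<close> comes out for every \<open>x\<close>: at a slice
    that is not integrable both sides are 0 by convention.\<close>
  also have "\<dots> = (\<integral>x. e1 x * (\<integral>y. F (y, x) * e2 y (T x) \<partial>nu) \<partial>mu)"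
    by (simp add: mult_ac flip: Bochner_Integration.integral_mult_right_zero)
  finally show ?thesis .
qed

text \<open>The factor \<open>\<phi>\<close> is constant in the inner integral over
  \<open>y\<close>, which vanishes where \<open>e1\<close> is positive. Integrability is asked of
  the product, since \<open>H\<close> alone may fail to be integrable. All centering statements
  below rest on this.\<close>

lemma integral_P_eq_zero:
  assumes [measurable]: "H \<in> borel_measurable (borel \<Otimes>\<^sub>M borel)" "\<phi> \<in> borel_measurable borel"
    and H: "AE x in mu. 0 < e1 x \<longrightarrow> (\<integral>y. H (y, T x) * e2 y (T x) \<partial>nu) = 0"
    and int: "integrable P (\<lambda>w. \<phi> (snd w) * H (fst w, T (snd w)))"
  shows "(\<integral>w. \<phi> (snd w) * H (fst w, T (snd w)) \<partial>P) = (0::real)"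
proof -
  have "(\<integral>w. \<phi> (snd w) * H (fst w, T (snd w)) \<partial>P) =
      (\<integral>x. e1 x * (\<phi> x * (\<integral>y. H (y, T x) * e2 y (T x) \<partial>nu)) \<partial>mu)"
    by (subst integral_P) (use int in \<open>simp_all add: mult.assoc\<close>)
  also have "\<dots> = 0"
  proof (rule integral_eq_zero_AE)
    show "AE x in mu. e1 x * (\<phi> x * (\<integral>y. H (y, T x) * e2 y (T x) \<partial>nu)) = 0"
      using H
    proof eventually_elim
      case (elim x)
      then show ?case using e1_nonneg[of x] by (cases "e1 x = 0") simp_all
    qed
  qed
  finally show ?thesis .
qed

lemma
  shows integrable_e2: "integrable nu (\<lambda>y. e2 y u)"
    and integral_e2: "(\<integral>y. e2 y u \<partial>nu) = 1"
proof -
  have m: "(\<lambda>y. e2 y u) \<in> borel_measurable nu" by measurable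
  show "integrable nu (\<lambda>y. e2 y u)"
    by (rule integrableI_nn_integral_finite[OF m, of 1]) (simp_all add: e2_nonneg e2_total)
  show "(\<integral>y. e2 y u \<partial>nu) = 1"
    by (subst integral_eq_nn_integral) (use m in \<open>simp_all add: e2_nonneg e2_total\<close>)
qed

text \<open>\<open>q (T x)\<close> is the conditional probability given \<open>x\<close> that (Y, u)
  lies in \<open>A\<close>. It depends on \<open>x\<close> only through the index because
  \<open>e2\<close> does, which is the source of conditional independence. Passing \<open>q\<close>
  by an equation lets two applications share it.\<close>

lemma integral_indicator_mult_snd:
  assumes A[measurable]: "A \<in> sets (borel \<Otimes>\<^sub>M borel)" and k[measurable]: "k \<in> borel_measurable borel"
    and int: "integrable P (\<lambda>w. k (snd w))"
    and q: "q = (\<lambda>u. \<integral>y. indicator A (y, u) * e2 y u \<partial>nu)"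
  shows "q \<in> borel_measurable borel"
    and "integrable P (\<lambda>w. q (T (snd w)) * k (snd w))"
    and "(\<integral>w. indicator A (fst w, T (snd w)) * k (snd w) \<partial>P) = (\<integral>w. q (T (snd w)) * k (snd w) \<partial>P)"
proof -
  show [measurable]: "q \<in> borel_measurable borel"
    unfolding q by measurable
  have q_bound: "\<bar>q u\<bar> \<le> 1" for u
  proof -
    have *: "integrable nu (\<lambda>y. indicator A (y, u) * e2 y u)"
      by (rule Bochner_Integration.integrable_bound[OF integrable_e2[of u]])
        (auto simp: indicator_def)
    have "0 \<le> q u" unfolding q by (simp add: e2_nonneg)
    moreover have "q u \<le> (\<integral>y. e2 y u \<partial>nu)"
      unfolding q by (rule integral_mono[OF * integrable_e2]) (auto simp: indicator_def e2_nonneg)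
    ultimately show ?thesis by (simp add: integral_e2)
  qed
  have [measurable]: "(\<lambda>w. k (snd w)) \<in> borel_measurable P"
      "(\<lambda>w. q (T (snd w))) \<in> borel_measurable P"
      "(\<lambda>w. indicat_real A (fst w, T (snd w))) \<in> borel_measurable P"
    by (rule measurable_P, measurable)+
  show 1: "integrable P (\<lambda>w. q (T (snd w)) * k (snd w))"
    by (rule Bochner_Integration.integrable_bound[OF int])
      (auto simp: abs_mult intro!: mult_left_le_one_le q_bound)
  have 2: "integrable P (\<lambda>w. indicator A (fst w, T (snd w)) * k (snd w))"
    by (rule Bochner_Integration.integrable_bound[OF int]) (measurable, simp add: indicator_def)
  have "(\<integral>w. indicator A (fst w, T (snd w)) * k (snd w) \<partial>P) =
      (\<integral>x. e1 x * (\<integral>y. k x * (indicator A (y, T x) * e2 y (T x)) \<partial>nu) \<partial>mu)"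
    by (subst integral_P[OF _ 2]) (simp_all add: mult_ac)
  \<comment> \<open>The inner integral is \<open>k x * q (T x)\<close>, constant in
    \<open>y\<close>; as \<open>e2\<close> has mass 1, it can be written back as an integral against
    \<open>e2\<close>.\<close>
  also have "\<dots> = (\<integral>x. e1 x * (\<integral>y. q (T x) * k x * e2 y (T x) \<partial>nu) \<partial>mu)"
    by (simp add: q integral_e2 mult_ac)
  also have "\<dots> = (\<integral>w. q (T (snd w)) * k (snd w) \<partial>P)"
    by (subst integral_P[OF _ 1]) simp_all
  finally show "(\<integral>w. indicator A (fst w, T (snd w)) * k (snd w) \<partial>P) = (\<integral>w. q (T (snd w)) * k (snd w) \<partial>P)" .
qed

section \<open>Conditioning on x, on u and on (Y, u)\<close>

definition F\<^sub>x :: "('y \<times> 'x) measure" where "F\<^sub>x = vimage_algebra (space P) snd borel"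
definition F\<^sub>u :: "('y \<times> 'x) measure" where "F\<^sub>u = vimage_algebra (space P) (\<lambda>w. T (snd w)) borel"
definition F\<^sub>y\<^sub>u :: "('y \<times> 'x) measure" where
  "F\<^sub>y\<^sub>u = vimage_algebra (space P) (\<lambda>w. (fst w, T (snd w))) (borel \<Otimes>\<^sub>M borel)"

lemma subalgebra_vimage_algebra:
  assumes "f \<in> measurable P N"
  shows "subalgebra P (vimage_algebra (space P) f N)"
  unfolding subalgebra_def using assms
  by (auto simp: sets_vimage_algebra2 measurable_space dest: measurable_sets)

sublocale X: finite_measure_subalgebra P F\<^sub>x
  by unfold_locales (unfold F\<^sub>x_def, rule subalgebra_vimage_algebra, rule measurable_P, measurable)
sublocale U: finite_measure_subalgebra P F\<^sub>u
  by unfold_locales (unfold F\<^sub>u_def, rule subalgebra_vimage_algebra, rule measurable_P, measurable)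
sublocale YU: finite_measure_subalgebra P F\<^sub>y\<^sub>u
  by unfold_locales (unfold F\<^sub>y\<^sub>u_def, rule subalgebra_vimage_algebra, rule measurable_P, measurable)

lemma sets_F\<^sub>x: "A \<in> sets F\<^sub>x \<Longrightarrow> \<exists>A'\<in>sets borel. \<forall>w. w \<in> A \<longleftrightarrow> snd w \<in> A'"
  and sets_F\<^sub>y\<^sub>u: "A \<in> sets F\<^sub>y\<^sub>u \<Longrightarrow> \<exists>A'\<in>sets (borel \<Otimes>\<^sub>M borel). \<forall>w. w \<in> A \<longleftrightarrow> (fst w, T (snd w)) \<in> A'"
  unfolding F\<^sub>x_def F\<^sub>y\<^sub>u_def
  by (subst (asm) sets_vimage_algebra2; auto simp: space_pair_measure)+

lemma
  fixes h :: "'u \<Rightarrow> real" and k :: "'y \<times> 'u \<Rightarrow> real"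
  shows measurable_F\<^sub>u: "h \<in> borel_measurable borel \<Longrightarrow> (\<lambda>w. h (T (snd w))) \<in> borel_measurable F\<^sub>u"
    and measurable_F\<^sub>y\<^sub>u: "k \<in> borel_measurable (borel \<Otimes>\<^sub>M borel) \<Longrightarrow> (\<lambda>w. k (fst w, T (snd w))) \<in> borel_measurable F\<^sub>y\<^sub>u"
  unfolding F\<^sub>u_def F\<^sub>y\<^sub>u_def
  by (rule measurable_compose[OF measurable_vimage_algebra1]; simp add: space_pair_measure)+

text \<open>\<open>Y\<close> and \<open>x\<close> are conditionally independent given \<open>u = T x\<close>.\<close>
lemma real_cond_exp_F\<^sub>y\<^sub>u_eq:
  assumes k[measurable]: "k \<in> borel_measurable borel" and int: "integrable P (\<lambda>w. k (snd w))"
    and e[measurable]: "e \<in> borel_measurable borel"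
    and ce: "AE w in P. real_cond_exp P F\<^sub>u (\<lambda>w. k (snd w)) w = e (T (snd w))"
  shows "AE w in P. real_cond_exp P F\<^sub>y\<^sub>u (\<lambda>w. k (snd w)) w = e (T (snd w))"
proof (rule YU.real_cond_exp_charact)
  have [measurable]: "(\<lambda>w. e (T (snd w))) \<in> borel_measurable P"
    by (rule measurable_P, measurable)
  show int_e: "integrable P (\<lambda>w. e (T (snd w)))"
    by (rule integrable_cong_AE_imp[OF U.real_cond_exp_int(1)[OF int]])
      (use ce in \<open>auto simp: eq_commute\<close>)
  show "(\<lambda>w. e (T (snd w))) \<in> borel_measurable F\<^sub>y\<^sub>u"
    using measurable_F\<^sub>y\<^sub>u[of "\<lambda>z. e (snd z)"] by simp
  show "integrable P (\<lambda>w. k (snd w))" by fact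
  fix A assume "A \<in> sets F\<^sub>y\<^sub>u"
  then obtain A' where A': "A' \<in> sets (borel \<Otimes>\<^sub>M borel)"
    and A: "\<And>w. w \<in> A \<longleftrightarrow> (fst w, T (snd w)) \<in> A'" using sets_F\<^sub>y\<^sub>u by blast
  have ind: "indicat_real A = (\<lambda>w. indicator A' (fst w, T (snd w)))"
    using A by (auto simp: indicator_def)
  define q where "q = (\<lambda>u. \<integral>y. indicator A' (y, u) * e2 y u \<partial>nu)"
  note k_facts = integral_indicator_mult_snd[OF A' k int q_def]
  have "(\<lambda>x. e (T x)) \<in> borel_measurable borel" by measurable
  note e_facts = integral_indicator_mult_snd[OF A' this int_e q_def]
  have qm: "(\<lambda>w. q (T (snd w))) \<in> borel_measurable F\<^sub>u"
    by (rule measurable_F\<^sub>u) (rule k_facts)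
  have km: "(\<lambda>w. k (snd w)) \<in> borel_measurable P" by (rule measurable_P, measurable)
  \<comment> \<open>The indicator of \<open>A\<close> is averaged to \<open>q\<close>, a function of
    u; conditioning on u replaces \<open>k\<close> by \<open>e\<close>; \<open>e_facts\<close>, with
    the same \<open>q\<close>, restores the indicator.\<close>
  have "(\<integral>w\<in>A. k (snd w) \<partial>P) = (\<integral>w. q (T (snd w)) * k (snd w) \<partial>P)"
    using k_facts(3) by (simp add: set_lebesgue_integral_def ind)
  also have "\<dots> = (\<integral>w. q (T (snd w)) * real_cond_exp P F\<^sub>u (\<lambda>w. k (snd w)) w \<partial>P)"
    by (rule U.real_cond_exp_intg(2)[symmetric, OF k_facts(2) qm km])
  also have "\<dots> = (\<integral>w. q (T (snd w)) * e (T (snd w)) \<partial>P)"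
  proof (rule integral_cong_AE)
    note [measurable] = k_facts(1)
    have [measurable]: "(\<lambda>w. q (T (snd w))) \<in> borel_measurable P"
      by (rule measurable_P, measurable)
    show "(\<lambda>w. q (T (snd w)) * real_cond_exp P F\<^sub>u (\<lambda>w. k (snd w)) w) \<in> borel_measurable P"
      "(\<lambda>w. q (T (snd w)) * e (T (snd w))) \<in> borel_measurable P" by measurable
    show "AE w in P. q (T (snd w)) * real_cond_exp P F\<^sub>u (\<lambda>w. k (snd w)) w = q (T (snd w)) * e (T (snd w))"
      using ce by eventually_elim simp
  qed
  also have "\<dots> = (\<integral>w\<in>A. e (T (snd w)) \<partial>P)"
    using e_facts(3) by (simp add: set_lebesgue_integral_def ind)
  finally show "(\<integral>w\<in>A. k (snd w) \<partial>P) = (\<integral>w\<in>A. e (T (snd w)) \<partial>P)" .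
qed

text \<open>The indicator of a set in \<open>F\<^sub>x\<close> is a function of x and is absorbed
  into \<open>\<phi>\<close>, so \<open>integral_P_eq_zero\<close> applies on every such
  set.\<close>

lemma real_cond_exp_F\<^sub>x_eq_zero:
  assumes [measurable]: "H \<in> borel_measurable (borel \<Otimes>\<^sub>M borel)" "\<phi> \<in> borel_measurable borel"
    and H: "AE x in mu. 0 < e1 x \<longrightarrow> (\<integral>y. H (y, T x) * e2 y (T x) \<partial>nu) = 0"
    and int: "integrable P (\<lambda>w. \<phi> (snd w) * H (fst w, T (snd w)))"
  shows "AE w in P. real_cond_exp P F\<^sub>x (\<lambda>w. \<phi> (snd w) * H (fst w, T (snd w))) w = (0::real)"
proof (rule X.real_cond_exp_charact)
  fix A assume "A \<in> sets F\<^sub>x"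
  then obtain A' where [measurable]: "A' \<in> sets borel" and A: "\<And>w. w \<in> A \<longleftrightarrow> snd w \<in> A'"
    using sets_F\<^sub>x by blast
  have ind: "indicat_real A = (\<lambda>w. indicator A' (snd w))"
    using A by (auto simp: indicator_def)
  have m: "(\<lambda>w. indicat_real A' (snd w) * \<phi> (snd w) * H (fst w, T (snd w))) \<in> borel_measurable P"
    by (rule measurable_P, measurable)
  have "integrable P (\<lambda>w. indicator A' (snd w) * \<phi> (snd w) * H (fst w, T (snd w)))"
    by (rule Bochner_Integration.integrable_bound[OF int m]) (simp add: indicator_def)
  then have "(\<integral>w. (indicator A' (snd w) * \<phi> (snd w)) * H (fst w, T (snd w)) \<partial>P) = 0"
    by (intro integral_P_eq_zero[where \<phi>="\<lambda>x. indicator A' x * \<phi> x"] H) auto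
  then show "(\<integral>w\<in>A. \<phi> (snd w) * H (fst w, T (snd w)) \<partial>P) = (\<integral>w\<in>A. 0 \<partial>P)"
    by (simp add: set_lebesgue_integral_def ind mult.assoc)
qed (use int in simp_all)

text \<open>The index is a function of x; the inclusion feeds the tower property in
  \<open>real_cond_exp_F\<^sub>u_eH\<close>.\<close>

lemma subalgebra_F\<^sub>x_F\<^sub>u: "subalgebra F\<^sub>x F\<^sub>u"
proof -
  have "(\<lambda>w. T (snd w)) \<in> measurable (vimage_algebra UNIV snd borel) borel"
    by (rule measurable_compose[OF measurable_vimage_algebra1 T]) simp
  then show ?thesis
    by (auto simp: subalgebra_def F\<^sub>x_def F\<^sub>u_def sets_vimage_algebra2[of _ UNIV "borel :: 'u measure"] dest: measurable_sets)
qed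

end

text \<open>A single score component: \<open>k\<close> stands for a coordinate x_l, \<open>e\<close>
  for a version of E(x_l | u), and \<open>H\<close> for the log-derivative G_j. Square integrability
  is imposed on the product, the form in which the score supplies it.\<close>

locale centered_score = index_model nu mu e1 e2 T
  for nu :: "'y::second_countable_topology measure"
    and mu :: "'x::second_countable_topology measure"
    and e1 :: "'x \<Rightarrow> real" and e2 :: "'y \<Rightarrow> 'u::second_countable_topology \<Rightarrow> real" and T :: "'x \<Rightarrow> 'u" +
  fixes k :: "'x \<Rightarrow> real" and e :: "'u \<Rightarrow> real" and H :: "'y \<times> 'u \<Rightarrow> real"
  assumes k[measurable]: "k \<in> borel_measurable borel" and k_int: "integrable P (\<lambda>w. k (snd w))"
    and e[measurable]: "e \<in> borel_measurable borel"
    and ce: "AE w in P. real_cond_exp P F\<^sub>u (\<lambda>w. k (snd w)) w = e (T (snd w))"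
    and H[measurable]: "H \<in> borel_measurable (borel \<Otimes>\<^sub>M borel)"
    and H_centered: "AE x in mu. 0 < e1 x \<longrightarrow> (\<integral>y. H (y, T x) * e2 y (T x) \<partial>nu) = 0"
    and sq: "integrable P (\<lambda>w. (k (snd w) * H (fst w, T (snd w)))\<^sup>2)"
begin

abbreviation kH :: "'y \<times> 'x \<Rightarrow> real" where "kH w \<equiv> k (snd w) * H (fst w, T (snd w))"
abbreviation eH :: "'y \<times> 'x \<Rightarrow> real" where "eH w \<equiv> e (T (snd w)) * H (fst w, T (snd w))"

lemma measurable_kH[measurable]: "kH \<in> borel_measurable P"
  and measurable_eH[measurable]: "eH \<in> borel_measurable P"
  by (rule measurable_P, measurable)+

lemma integrable_kH: "integrable P kH"
  by (rule P.square_integrable_imp_integrable[OF measurable_kH sq])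

text \<open>\<open>H\<close> is a function of (Y, u) and leaves the conditional expectation;
  conditional independence evaluates the remaining factor as \<open>e\<close>.\<close>

lemma real_cond_exp_kH: "AE w in P. real_cond_exp P F\<^sub>y\<^sub>u kH w = eH w"
proof -
  have HF: "(\<lambda>w. H (fst w, T (snd w))) \<in> borel_measurable F\<^sub>y\<^sub>u"
    by (rule measurable_F\<^sub>y\<^sub>u) measurable
  have m: "(\<lambda>w. k (snd w)) \<in> borel_measurable P" by (rule measurable_P, measurable)
  have "AE w in P. real_cond_exp P F\<^sub>y\<^sub>u (\<lambda>w. H (fst w, T (snd w)) * k (snd w)) w
      = H (fst w, T (snd w)) * real_cond_exp P F\<^sub>y\<^sub>u (\<lambda>w. k (snd w)) w"
    by (rule YU.real_cond_exp_mult[OF HF m]) (use integrable_kH in \<open>simp add: mult.commute\<close>)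
  then show ?thesis
    using real_cond_exp_F\<^sub>y\<^sub>u_eq[OF k k_int e ce]
    by eventually_elim (simp add: mult.commute)
qed

text \<open>There is no separate bound on \<open>e\<close> or \<open>H\<close>; the claim holds
  because \<open>eH\<close> is a conditional expectation of \<open>kH\<close>.\<close>

lemma square_integrable_eH: "integrable P (\<lambda>w. (eH w)\<^sup>2)"
proof (rule integrable_cong_AE_imp[OF YU.integrable_square_real_cond_exp[OF measurable_kH sq]])
  show "(\<lambda>w. (eH w)\<^sup>2) \<in> borel_measurable P"
    by (rule borel_measurable_power[OF measurable_eH])
  show "AE w in P. (real_cond_exp P F\<^sub>y\<^sub>u kH w)\<^sup>2 = (eH w)\<^sup>2"
    using real_cond_exp_kH by eventually_elim simp
qed

lemma integrable_eH: "integrable P eH"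
  by (rule P.square_integrable_imp_integrable[OF measurable_eH square_integrable_eH])

lemma integral_kH: "(\<integral>w. kH w \<partial>P) = 0"
  by (rule integral_P_eq_zero[OF H k H_centered integrable_kH])

lemma integral_eH: "(\<integral>w. eH w \<partial>P) = 0"
  by (rule integral_P_eq_zero[OF H _ H_centered, where \<phi>="\<lambda>x. e (T x)"]) (measurable, rule integrable_eH)

lemma real_cond_exp_F\<^sub>x_eH: "AE w in P. real_cond_exp P F\<^sub>x eH w = 0"
  by (rule real_cond_exp_F\<^sub>x_eq_zero[OF H _ H_centered, where \<phi>="\<lambda>x. e (T x)"]) (measurable, rule integrable_eH)

text \<open>Tower property: conditioning on x first already gives 0.\<close>

lemma real_cond_exp_F\<^sub>u_eH: "AE w in P. real_cond_exp P F\<^sub>u eH w = 0"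
proof -
  have "AE w in P. real_cond_exp P F\<^sub>u (real_cond_exp P F\<^sub>x eH) w = real_cond_exp P F\<^sub>u eH w"
    by (rule U.real_cond_exp_nested_subalg[OF X.subalg subalgebra_F\<^sub>x_F\<^sub>u integrable_eH])
  moreover have "AE w in P. real_cond_exp P F\<^sub>u (real_cond_exp P F\<^sub>x eH) w = real_cond_exp P F\<^sub>u (\<lambda>_. 0) w"
    by (rule U.real_cond_exp_cong[OF real_cond_exp_F\<^sub>x_eH]) auto
  moreover have "AE w in P. real_cond_exp P F\<^sub>u (\<lambda>_. 0) w = 0"
    by (rule U.real_cond_exp_F_meas) auto
  ultimately show ?thesis by eventually_elim simp
qed

text \<open>Orthogonality to \<open>tangent1\<close>: the difference is (k - e) H, so together with
  \<open>\<phi>\<close> it is a function of x times a factor centered given x.\<close>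

lemma integral_fun_x_mult:
  assumes [measurable]: "\<phi> \<in> borel_measurable borel" and sq\<phi>: "integrable P (\<lambda>w. (\<phi> (snd w))\<^sup>2)"
  shows "(\<integral>w. \<phi> (snd w) * (kH w - eH w) \<partial>P) = 0"
proof -
  have m: "(\<lambda>w. \<phi> (snd w)) \<in> borel_measurable P" by (rule measurable_P, measurable)
  have eq: "(\<lambda>w. \<phi> (snd w) * (kH w - eH w)) =
      (\<lambda>w. (\<phi> (snd w) * (k (snd w) - e (T (snd w)))) * H (fst w, T (snd w)))"
    by (auto simp: algebra_simps)
  have "integrable P (\<lambda>w. (kH w - eH w)\<^sup>2)"
    using integrable_square_diff[OF measurable_kH measurable_eH] sq square_integrable_eH by simp
  then have "integrable P (\<lambda>w. \<phi> (snd w) * (kH w - eH w))"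
    by (rule integrable_mult_of_square[OF m borel_measurable_diff[OF measurable_kH measurable_eH] sq\<phi>])
  then show ?thesis
    unfolding eq
    by (rule integral_P_eq_zero[OF H _ H_centered, where \<phi>="\<lambda>x. \<phi> x * (k x - e (T x))", rotated]) measurable
qed

text \<open>Orthogonality to \<open>tangent2\<close>: \<open>eH\<close> is the conditional
  expectation of \<open>kH\<close> given (Y, u), so both have the same integral against
  square-integrable functions of (Y, u).\<close>

lemma integral_fun_yu_mult:
  assumes h[measurable]: "h \<in> borel_measurable (borel \<Otimes>\<^sub>M borel)"
    and sqh: "integrable P (\<lambda>w. (h (fst w, T (snd w)))\<^sup>2)"
  shows "(\<integral>w. h (fst w, T (snd w)) * (kH w - eH w) \<partial>P) = 0"
proof -
  let ?h = "\<lambda>w. h (fst w, T (snd w))"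
  have hP: "?h \<in> borel_measurable P" by (rule measurable_P, measurable)
  have hF: "?h \<in> borel_measurable F\<^sub>y\<^sub>u" by (rule measurable_F\<^sub>y\<^sub>u) measurable
  have int: "integrable P (\<lambda>w. ?h w * kH w)" "integrable P (\<lambda>w. ?h w * eH w)"
    by (rule integrable_mult_of_square[OF hP measurable_kH sqh sq])
      (rule integrable_mult_of_square[OF hP measurable_eH sqh square_integrable_eH])
  have "(\<integral>w. ?h w * kH w \<partial>P) = (\<integral>w. ?h w * real_cond_exp P F\<^sub>y\<^sub>u kH w \<partial>P)"
    by (rule YU.real_cond_exp_intg(2)[symmetric, OF int(1) hF measurable_kH])
  also have "\<dots> = (\<integral>w. ?h w * eH w \<partial>P)"
  proof (rule integral_cong_AE)
    show "(\<lambda>w. ?h w * real_cond_exp P F\<^sub>y\<^sub>u kH w) \<in> borel_measurable P"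
      by (rule borel_measurable_times[OF hP borel_measurable_cond_exp2])
    show "(\<lambda>w. ?h w * eH w) \<in> borel_measurable P"
      by (rule borel_measurable_times[OF hP measurable_eH])
    show "AE w in P. ?h w * real_cond_exp P F\<^sub>y\<^sub>u kH w = ?h w * eH w"
      using real_cond_exp_kH by eventually_elim simp
  qed
  finally show ?thesis
    using int by (simp add: right_diff_distrib)
qed

end

subsection \<open>Derivatives of the log-likelihood\<close>

text \<open>
  \<open>\<partial> log f / \<partial>u\<^sub>j\<close> as a limit along one fixed null sequence: unlike the pointwise gradient, this is a Borel
  function of \<open>(y, u)\<close> without any differentiability assumption. Where \<open>f y u = 0\<close> its value is \<open>0\<close>, which
  agrees with \<open>log_partial f j * f = \<partial>f / \<partial>u\<^sub>j\<close> since a nonnegative \<open>f\<close> has a minimum there.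
\<close>
definition log_partial :: "('y \<Rightarrow> real^'d \<Rightarrow> real) \<Rightarrow> 'd \<Rightarrow> 'y \<times> (real^'d) \<Rightarrow> real" where
  "log_partial f j = (\<lambda>(y, u).
     lim (\<lambda>n. (f y (u + inverse (real (Suc n)) *\<^sub>R axis j 1) - f y u) / inverse (real (Suc n))) / f y u)"

lemma borel_measurable_log_partial:
  fixes f :: "'y::second_countable_topology \<Rightarrow> real^'d \<Rightarrow> real"
  assumes f: "(\<lambda>(y, u). f y u) \<in> borel_measurable (borel \<Otimes>\<^sub>M borel)"
  shows "log_partial f j \<in> borel_measurable (borel \<Otimes>\<^sub>M borel)"
proof -
  have [measurable]: "(\<lambda>w. f (fst w) (snd w + a)) \<in> borel_measurable (borel \<Otimes>\<^sub>M borel)" for a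
    using measurable_compose[OF measurable_Pair[of fst _ _ "\<lambda>w. snd w + a"] f] by simp
  have [measurable]: "(\<lambda>w. f (fst w) (snd w)) \<in> borel_measurable (borel \<Otimes>\<^sub>M borel)"
    using f by (simp add: split_beta')
  show ?thesis
    unfolding log_partial_def split_beta'
    by (intro borel_measurable_divide borel_measurable_lim_metric) measurable
qed

lemma log_partial_eq:
  assumes "(f y has_derivative D) (at u)"
  shows "log_partial f j (y, u) = D (axis j 1) / f y u"
proof -
  interpret D: linear D using assms by (rule has_derivative_linear)
  have "((\<lambda>t. u + t *\<^sub>R axis j 1) has_derivative (\<lambda>t. 0 + t *\<^sub>R axis j 1)) (at 0)"
    by (intro has_derivative_add has_derivative_const has_derivative_scaleR_left has_derivative_ident)
  then have "((\<lambda>t. f y (u + t *\<^sub>R axis j 1)) has_derivative (\<lambda>t. D (t *\<^sub>R axis j 1))) (at 0)"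
    by (rule has_derivative_compose[where g="f y", THEN has_derivative_eq_rhs]) (use assms in simp_all)
  then have "((\<lambda>t. f y (u + t *\<^sub>R axis j 1)) has_real_derivative D (axis j 1)) (at 0)"
    by (rule has_derivative_imp_has_field_derivative) (simp add: D.scale mult.commute)
  then have "((\<lambda>t. (f y (u + t *\<^sub>R axis j 1) - f y u) / t) \<longlongrightarrow> D (axis j 1)) (at 0)"
    by (simp add: DERIV_def)
  \<comment> \<open>The steps are never 0, as the punctured filter \<open>at 0\<close>
    requires.\<close>
  moreover have "filterlim (\<lambda>n. inverse (real (Suc n))) (at 0) sequentially"
    using LIMSEQ_inverse_real_of_nat by (auto simp: filterlim_at simp del: of_nat_Suc)
  ultimately have "(\<lambda>n. (f y (u + inverse (real (Suc n)) *\<^sub>R axis j 1) - f y u) / inverse (real (Suc n)))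
      \<longlonglongrightarrow> D (axis j 1)"
    by (rule filterlim_compose)
  then show ?thesis by (simp only: log_partial_def prod.case limI)
qed

lemma log_partial_mult:
  assumes D: "(f y has_derivative D) (at u)" and nonneg: "\<And>v. 0 \<le> f y v"
  shows "log_partial f j (y, u) * f y u = D (axis j 1)"
proof (cases "f y u = 0")
  case True
  then have "D = (\<lambda>_. 0)"
    using differential_zero_maxmin[OF _ open_UNIV D] nonneg by simp
  then show ?thesis using True by simp
qed (simp add: log_partial_eq[where f=f, OF D])

lemma gradient_ln:
  assumes D: "(f y has_derivative D) (at u)" and "0 < f y u"
  shows "gradient (\<lambda>v. ln (f y v)) u $ j = log_partial f j (y, u)"
proof -
  have "((\<lambda>v. ln (f y v)) has_derivative (\<lambda>h. D h / f y u)) (at u)"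
    using assms by (auto intro!: derivative_eq_intros simp: divide_inverse)
  from frechet_derivative_at[OF this, symmetric] show ?thesis
    by (simp add: gradient_def log_partial_eq[where f=f, OF D])
qed

text \<open>The identity block contributes the upper coordinates without any parameter, so the index
  is affine in \<open>t\<close> with the lower coordinates of \<open>x\<close> as
  coefficients.\<close>

lemma transpose_beta_mat_mult_nth:
  "(transpose (beta_mat (unvecl t)) *v x) $ j = x $ Inl j + (\<Sum>l\<in>UNIV. t $ (j, l) * x $ Inr l)"
  for x :: "real^('d::finite + 'm::finite)"
proof -
  have "(transpose (beta_mat (unvecl t)) *v x) $ j
      = (\<Sum>i\<in>UNIV <+> UNIV. beta_mat (unvecl t) $ i $ j * x $ i)"
    by (simp add: matrix_vector_mult_def transpose_def)
  also have "\<dots> = (\<Sum>k\<in>UNIV. mat 1 $ k $ j * x $ Inl k) + (\<Sum>l\<in>UNIV. t $ (j, l) * x $ Inr l)"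
    by (subst sum.Plus) (simp_all add: beta_mat_def unvecl_def)
  also have "(\<Sum>k\<in>UNIV. mat 1 $ k $ j * x $ Inl k) = x $ Inl j"
    by (simp add: mat_def if_distrib[of "\<lambda>a. a * b" for b] cong: if_cong)
  finally show ?thesis .
qed

text \<open>Chain rule: for \<open>k = (j, l)\<close>, perturbing that parameter moves the index
  along axis j at rate x_l, with l among the lower coordinates.\<close>

lemma score_nth:
  fixes Bl :: "real^'d^'m"
  assumes D: "(eta2 y has_derivative D) (at (transpose (beta_mat Bl) *v x))"
    and pos: "0 < eta1 x" "0 < eta2 y (transpose (beta_mat Bl) *v x)"
  shows "score eta1 eta2 Bl (y, x) $ k
    = x $ Inr (snd k) * log_partial eta2 (fst k) (y, transpose (beta_mat Bl) *v x)"
proof -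
  let ?t = "vecl (beta_mat Bl)" and ?A = "\<lambda>t. transpose (beta_mat (unvecl t)) *v x"
  let ?A' = "\<lambda>h. \<chi> j. \<Sum>l\<in>UNIV. h $ (j, l) * x $ Inr l"
  interpret D: linear D using D by (rule has_derivative_linear)
  have A0: "?A ?t = transpose (beta_mat Bl) *v x" by (simp add: unvecl_vecl_beta_mat)
  have "bounded_linear ?A'"
    by (intro linear_conv_bounded_linear[THEN iffD1] linearI)
      (simp_all add: vec_eq_iff algebra_simps sum.distrib sum_distrib_left)
  moreover have "?A = (\<lambda>t. (\<chi> j. x $ Inl j) + ?A' t)"
    by (intro ext) (simp only: vec_eq_iff vector_add_component transpose_beta_mat_mult_nth vec_lambda_beta, simp)
  ultimately have "(?A has_derivative (\<lambda>h. 0 + ?A' h)) (at ?t)"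
    by (simp only:) (intro has_derivative_add has_derivative_const bounded_linear_imp_has_derivative)
  then have "((\<lambda>t. eta2 y (?A t)) has_derivative (\<lambda>h. D (?A' h))) (at ?t)"
    by (rule has_derivative_compose[where g="eta2 y", THEN has_derivative_eq_rhs]) (simp_all only: A0 D add_0)
  then have d: "((\<lambda>t. eta1 x * eta2 y (?A t)) has_derivative (\<lambda>h. eta1 x * D (?A' h))) (at ?t)"
    by (rule has_derivative_mult_right)
  \<comment> \<open>\<open>eta1 x\<close> is free of the parameter and cancels in the logarithmic
    derivative.\<close>
  have "((\<lambda>t. ln (eta1 x * eta2 y (?A t))) has_derivative (\<lambda>h. D (?A' h) / eta2 y (?A ?t))) (at ?t)"
    by (rule has_derivative_ln[OF _ d, THEN has_derivative_eq_rhs])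
      (use pos in \<open>simp_all add: unvecl_vecl_beta_mat field_simps\<close>)
  from frechet_derivative_at[OF this, symmetric]
  have "score eta1 eta2 Bl (y, x) $ k = D (?A' (axis k 1)) / eta2 y (?A ?t)"
    by (simp only: score_def gradient_def prod.case vec_lambda_beta)
  moreover have "?A' (axis k 1) = x $ Inr (snd k) *\<^sub>R axis (fst k) 1"
  proof -
    have "(\<Sum>l\<in>UNIV. axis k 1 $ (j, l) * x $ Inr l) = (if j = fst k then x $ Inr (snd k) else 0)" for j
      by (cases k) (auto simp: axis_def if_distrib[of "\<lambda>a. a * b" for b] cong: if_cong)
    then show ?thesis by (auto simp: vec_eq_iff axis_def)
  qed
  ultimately show ?thesis
    by (simp only: log_partial_eq[where f=eta2, OF D] A0 D.scale real_scaleR_def times_divide_eq_right)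
qed

text \<open>A score has mean zero: the total mass is constantly 1, so its derivative vanishes. The
  interchange moves the derivative inside, where \<open>log_partial_mult\<close> matches it with the
  integrand, also at zeros of \<open>f\<close>.\<close>

lemma integral_log_partial_eq_zero:
  assumes int: "\<And>v. (\<integral>y. f y v \<partial>nu) = 1" and nonneg: "\<And>y v. 0 \<le> f y v"
    and meas: "(\<lambda>y. log_partial f j (y, u) * f y u) \<in> borel_measurable nu"
    and diff: "diff_under_integral nu f u"
  shows "(\<integral>y. log_partial f j (y, u) * f y u \<partial>nu) = 0"
proof -
  obtain D where D: "AE y in nu. (f y has_derivative D y) (at u)" "\<And>h. integrable nu (\<lambda>y. D y h)"
    and "((\<lambda>v. \<integral>y. f y v \<partial>nu) has_derivative (\<lambda>h. \<integral>y. D y h \<partial>nu)) (at u)"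
    using diff unfolding diff_under_integral_def by blast
  then have "((\<lambda>v. 1) has_derivative (\<lambda>h. \<integral>y. D y h \<partial>nu)) (at u)"
    by (simp add: int)
  then have "(\<lambda>h. \<integral>y. D y h \<partial>nu) = (\<lambda>_. 0)"
    using has_derivative_const by (rule has_derivative_unique)
  moreover have "(\<integral>y. log_partial f j (y, u) * f y u \<partial>nu) = (\<integral>y. D y (axis j 1) \<partial>nu)"
  proof (rule integral_cong_AE[OF meas])
    show "(\<lambda>y. D y (axis j 1)) \<in> borel_measurable nu" using D(2) by (rule borel_measurable_integrable)
    show "AE y in nu. log_partial f j (y, u) * f y u = D y (axis j 1)"
      using D(1) by eventually_elim (rule log_partial_mult, simp_all add: nonneg)
  qed
  ultimately show ?thesis by (simp add: fun_eq_iff)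
qed

subsection \<open>The efficient score\<close>

theorem mainTheorem1:
  fixes nu :: "real measure"
    and mu :: "(real^('d::finite + 'm::finite)) measure"
    and eta1 :: "real^('d + 'm) \<Rightarrow> real"
    and eta2 :: "real \<Rightarrow> real^'d \<Rightarrow> real"
    and Bl :: "real^'d^'m"
  defines "B \<equiv> beta_mat Bl"
  defines "P \<equiv> obs_law nu mu eta1 eta2 B"
  assumes dominating: "sigma_finite_measure nu" "sets nu = sets borel"
      "sigma_finite_measure mu" "sets mu = sets borel"
    and eta1: "eta1 \<in> borel_measurable borel" "\<And>x. 0 \<le> eta1 x"
      "(\<integral>\<^sup>+ x. ennreal (eta1 x) \<partial>mu) = 1"
    and eta2: "(\<lambda>(y, u). eta2 y u) \<in> borel_measurable (borel \<Otimes>\<^sub>M borel)" "\<And>y u. 0 \<le> eta2 y u"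
      "\<And>u. (\<integral>\<^sup>+ y. ennreal (eta2 y u) \<partial>nu) = 1"
    and moments: "integrable P (\<lambda>(y, x). (norm x)\<^sup>2)"
      "(\<integral>(y, x). x \<partial>P) = 0"
      "\<And>i j. (\<integral>(y, x). x $ i * x $ j \<partial>P) = mat 1 $ i $ j"
    and no_deterministic: "\<not> (\<exists>a h. a \<notin> span (columns B) \<and> h \<in> borel_measurable borel \<and>
      (AE (y, x) in P. a \<bullet> x = h (transpose B *v x)))"
    and differentiable: "AE (y, x) in P. eta2 y differentiable (at (transpose B *v x))"
    and interchange: "AE (y, x) in P. diff_under_integral nu eta2 (transpose B *v x)"
    and score_sq_int: "integrable P (\<lambda>w. (norm (score eta1 eta2 Bl w))\<^sup>2)"
  shows "is_projection P (score eta1 eta2 Bl) (orth_compl P (nuisance_tangent P B)) S_eff \<longleftrightarrow>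
    (AE (y, x) in P. S_eff (y, x) =
       vecl (outer (x - cond_exp_given P (\<lambda>(y, x). transpose B *v x) snd (y, x))
                   (gradient (\<lambda>u. ln (eta2 y u)) (transpose B *v x))))"
proof -

  \<comment> \<open>Reduction to the abstract model and a Borel version of the score\<close>
  define T where "T = (\<lambda>x. transpose B *v x)"
  interpret nu: sigma_finite_measure nu by fact
  interpret mu: sigma_finite_measure mu by fact
  have T_meas: "T \<in> borel_measurable borel"
    unfolding T_def
    by (intro borel_measurable_continuous_onI linear_continuous_on matrix_vector_mul_bounded_linear)
  interpret M: index_model nu mu eta1 eta2 T
    by unfold_locales (fact dominating eta1 eta2 T_meas)+
  have P: "M.P = P"
    unfolding M.P_def P_def obs_law_def by (simp only: T_def)
  have T_eq: "transpose B *v x = T x" for x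
    by (simp only: T_def)
  define G where "G = log_partial eta2"
  have G[measurable]: "G j \<in> borel_measurable (borel \<Otimes>\<^sub>M borel)" for j
    unfolding G_def using eta2(1) by (rule borel_measurable_log_partial)
  have k_meas[measurable]: "(\<lambda>x :: real^('d + 'm). x $ i) \<in> borel_measurable borel" for i :: "'d + 'm"
    by (rule borel_measurable_vec_nth_comp) simp
  have k_meas_P: "(\<lambda>w. snd w $ i) \<in> borel_measurable P" for i
    unfolding P[symmetric] by (rule M.measurable_P, measurable)
  have k_int: "integrable P (\<lambda>w. snd w $ i)" for i
  proof -
    have "integrable P (\<lambda>w. (snd w $ i)\<^sup>2)"
      by (intro Bochner_Integration.integrable_bound[OF moments(1)] borel_measurable_power k_meas_P)
        (simp add: split_beta' component_square_le_norm_square)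
    then show ?thesis
      unfolding P[symmetric] by (rule M.P.square_integrable_imp_integrable[OF k_meas_P[unfolded P[symmetric]]])
  qed
  \<comment> \<open>\<open>real_cond_exp\<close> is itself \<open>F\<^sub>u\<close>-measurable, so
    it factors through \<open>T\<close> at every point and not merely almost surely. The resulting
    \<open>e l\<close> represents E(x_l | u).\<close>
  have "\<exists>e. e \<in> borel_measurable borel \<and>
      (\<forall>w. real_cond_exp P M.F\<^sub>u (\<lambda>w. snd w $ Inr l) w = e (T (snd w)))" for l
  proof -
    have "real_cond_exp P M.F\<^sub>u (\<lambda>w. snd w $ Inr l) \<in>
        borel_measurable (vimage_algebra (space P) (\<lambda>w. T (snd w)) borel)"
      unfolding M.F\<^sub>u_def P[symmetric] by (rule borel_measurable_cond_exp)
    then show ?thesis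
      by (rule vimage_algebra_factor_real[rotated]) (auto simp flip: P)
  qed
  then obtain e where e_meas: "\<And>l. e l \<in> borel_measurable borel"
    and e: "\<And>l w. real_cond_exp P M.F\<^sub>u (\<lambda>w. snd w $ Inr l) w = e l (T (snd w))"
    by metis
  note [measurable] = e_meas

  \<comment> \<open>\<open>SG\<close> is a Borel version of the score and \<open>R\<close> one of its conditional expectation given \<open>(Y, u)\<close>.\<close>
  define SG :: "real \<times> (real^('d + 'm)) \<Rightarrow> real^('d \<times> 'm)" where
    "SG = (\<lambda>w. \<chi> k. snd w $ Inr (snd k) * G (fst k) (fst w, T (snd w)))"
  define R :: "real \<times> (real^('d + 'm)) \<Rightarrow> real^('d \<times> 'm)" where
    "R = (\<lambda>w. \<chi> k. e (snd k) (T (snd w)) * G (fst k) (fst w, T (snd w)))"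
  have pos: "AE w in P. 0 < eta1 (snd w) \<and> 0 < eta2 (fst w) (T (snd w))"
    using M.AE_P_pos unfolding P by (simp add: split_beta')
  have diff: "AE w in P. eta2 (fst w) differentiable (at (T (snd w)))"
    using differentiable unfolding T_eq by (simp add: split_beta')
  \<comment> \<open>The derivative formula for the score requires a positive density and
    differentiability at the index; both hold almost surely.\<close>
  have S_eq: "AE w in P. score eta1 eta2 Bl w = SG w"
    using pos diff
  proof eventually_elim
    case (elim w)
    then obtain D where "(eta2 (fst w) has_derivative D) (at (T (snd w)))"
      by (auto simp: differentiable_def)
    then show ?case
      using elim score_nth[of eta2 "fst w" D Bl "snd w" eta1]
      by (simp add: vec_eq_iff SG_def G_def T_def B_def)
  qed

  have SG_meas: "(\<lambda>w. SG w $ k) \<in> borel_measurable P" for k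
    unfolding SG_def vec_lambda_beta P[symmetric] by (rule M.measurable_P, measurable)
  have R_meas: "(\<lambda>w. R w $ k) \<in> borel_measurable P" for k
    unfolding R_def vec_lambda_beta P[symmetric] by (rule M.measurable_P, measurable)
  have SG_sq: "integrable P (\<lambda>w. (SG w $ k)\<^sup>2)" for k
  proof (rule Bochner_Integration.integrable_bound[OF score_sq_int])
    show "(\<lambda>w. (SG w $ k)\<^sup>2) \<in> borel_measurable P"
      using SG_meas by (rule borel_measurable_power)
    show "AE w in P. norm ((SG w $ k)\<^sup>2) \<le> norm ((norm (score eta1 eta2 Bl w))\<^sup>2)"
      using S_eq
    proof eventually_elim
      case (elim w)
      then show ?case using component_square_le_norm_square[of "SG w" k] by simp
    qed
  qed
  have G_centered: "AE x in mu. 0 < eta1 x \<longrightarrow> (\<integral>y. G j (y, T x) * eta2 y (T x) \<partial>nu) = 0" for j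
  proof -
    \<comment> \<open>The interchange condition concerns x alone, so it passes from the joint law to
      almost every \<open>x\<close> with \<open>eta1 x\<close> positive.\<close>
    from M.AE_P_snd[OF interchange[unfolded T_eq P[symmetric]]] show ?thesis
    proof eventually_elim
      case (elim x)
      have m: "(\<lambda>y. log_partial eta2 j (y, T x) * eta2 y (T x)) \<in> borel_measurable nu"
        unfolding G_def[symmetric] by measurable
      show ?case
        using elim integral_log_partial_eq_zero[OF M.integral_e2 eta2(2) m] by (simp add: G_def)
    qed
  qed
  \<comment> \<open>Each entry of the score becomes an instance of the one-component analysis, with
    \<open>SG_sq\<close> supplying the square integrability of the product.\<close>
  have cs: "centered_score nu mu eta1 eta2 T (\<lambda>x. x $ Inr l) (e l) (G j)" for l j
  proof unfold_locales
    show "integrable M.P (\<lambda>w. snd w $ Inr l)" unfolding P by (rule k_int)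
    show "AE w in M.P. real_cond_exp M.P M.F\<^sub>u (\<lambda>w. snd w $ Inr l) w = e l (T (snd w))"
      by (simp add: P e)
    show "integrable M.P (\<lambda>w. (snd w $ Inr l * G j (fst w, T (snd w)))\<^sup>2)"
      using SG_sq[of "(j, l)"] by (simp add: P SG_def)
  qed (rule k_meas e_meas G G_centered)+
  have prob: "prob_space P" and compl: "complete_measure P"
    using M.prob_space_P M.complete_P by (simp_all add: P)
  have SG_H: "SG \<in> hilbert_space P"
    by (rule hilbert_space_memI[OF prob SG_meas SG_sq])
      (simp add: SG_def centered_score.integral_kH[OF cs, unfolded P])
  have R_H: "R \<in> hilbert_space P"
    by (rule hilbert_space_memI[OF prob R_meas])
      (simp_all add: R_def centered_score.integral_eH[OF cs, unfolded P]
        centered_score.square_integrable_eH[OF cs, unfolded P])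
  \<comment> \<open>The candidate for the efficient score: what remains after subtracting the
    conditional expectation given (Y, u).\<close>
  define s where "s = (\<lambda>w. SG w - R w)"
  have s_H: "s \<in> hilbert_space P"
    unfolding s_def using prob SG_H R_H by (rule hilbert_space_diff)
  have S_H: "score eta1 eta2 Bl \<in> hilbert_space P"
    by (rule hilbert_space_cong_AE[OF compl _ SG_H]) (use S_eq in \<open>eventually_elim, simp\<close>)
  have H_meas: "f \<in> borel_measurable P" if "f \<in> hilbert_space P" for f :: "real \<times> (real^('d + 'm)) \<Rightarrow> real^('d \<times> 'm)"
    using that by (simp add: hilbert_space_def)

  \<comment> \<open>Orthogonality of \<open>s\<close> to the nuisance tangent space\<close>
  have orth1: "cov_inner P f s = 0" if f: "f \<in> tangent1 P" for f
  proof -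
    obtain h where h: "h \<in> borel_measurable borel" "AE w in P. f w = h (snd w)" and fH: "f \<in> hilbert_space P"
      using f by (auto simp: tangent1_def split_beta')
    \<comment> \<open>\<open>f\<close> is a function of x only almost surely; its representative
      \<open>h\<close> is one everywhere, as \<open>integral_fun_x_mult\<close> demands.\<close>
    have hH: "(\<lambda>w. h (snd w)) \<in> hilbert_space P"
      by (rule hilbert_space_cong_AE[OF compl h(2) fH])
    have "cov_inner P f s = cov_inner P (\<lambda>w. h (snd w)) s"
      by (rule cov_inner_cong_AE[OF compl h(2)]) (intro H_meas s_H fH)+
    also have "\<dots> = (\<Sum>k\<in>UNIV. \<integral>w. h (snd w) $ k * s w $ k \<partial>P)"
      by (rule cov_inner_eq_sum[OF hH s_H])
    also have "\<dots> = 0"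
    proof (rule sum.neutral, rule ballI)
      fix k
      show "(\<integral>w. h (snd w) $ k * s w $ k \<partial>P) = 0"
        using centered_score.integral_fun_x_mult[OF cs, of "\<lambda>x. h x $ k" "snd k" "fst k", unfolded P]
          borel_measurable_vec_nth_comp[OF h(1)] hilbert_space_component(2)[OF hH]
        by (simp add: s_def SG_def R_def)
    qed
    finally show ?thesis .
  qed
  have orth2: "cov_inner P f s = 0" if f: "f \<in> tangent2 P B" for f
  proof -
    obtain h where h: "h \<in> borel_measurable borel" "AE w in P. f w = h (fst w, T (snd w))" and fH: "f \<in> hilbert_space P"
      using f unfolding tangent2_def T_eq by (auto simp: split_beta')
    have hH: "(\<lambda>w. h (fst w, T (snd w))) \<in> hilbert_space P"
      by (rule hilbert_space_cong_AE[OF compl h(2) fH])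
    have "cov_inner P f s = cov_inner P (\<lambda>w. h (fst w, T (snd w))) s"
      by (rule cov_inner_cong_AE[OF compl h(2)]) (intro H_meas s_H fH)+
    also have "\<dots> = (\<Sum>k\<in>UNIV. \<integral>w. h (fst w, T (snd w)) $ k * s w $ k \<partial>P)"
      by (rule cov_inner_eq_sum[OF hH s_H])
    also have "\<dots> = 0"
    proof (rule sum.neutral, rule ballI)
      fix k
      show "(\<integral>w. h (fst w, T (snd w)) $ k * s w $ k \<partial>P) = 0"
        using centered_score.integral_fun_yu_mult[OF cs, of "\<lambda>z. h z $ k" "snd k" "fst k", unfolded P]
          borel_measurable_vec_nth_comp[OF h(1)] hilbert_space_component(2)[OF hH]
        by (simp add: s_def SG_def R_def borel_prod)
    qed
    finally show ?thesis .
  qed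
  have s_orth: "s \<in> orth_compl P (nuisance_tangent P B)"
  proof -
    have "cov_inner P (\<lambda>w. f1 w + f2 w) s = 0" if "f1 \<in> tangent1 P" "f2 \<in> tangent2 P B" for f1 f2
    proof -
      have "cov_inner P (\<lambda>w. f1 w + f2 w) s = cov_inner P f1 s + cov_inner P f2 s"
        unfolding cov_inner_def inner_add_left
        using that s_H by (intro Bochner_Integration.integral_add integrable_cov_inner) (auto simp: tangent1_def tangent2_def)
      then show ?thesis using that by (simp add: orth1 orth2)
    qed
    then show ?thesis using s_H by (auto simp: orth_compl_def nuisance_tangent_def)
  qed

  \<comment> \<open>Membership of \<open>R\<close> in the nuisance tangent space, and the
    projection\<close>
  have "R \<in> tangent2 P B"
  proof -
    let ?h = "\<lambda>z. \<chi> k. e (snd k) (snd z) * G (fst k) z"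
    have h: "?h \<in> borel_measurable borel"
    proof (rule borel_measurable_vecI)
      show "(\<lambda>z. ?h z $ k) \<in> borel_measurable borel" for k
        unfolding vec_lambda_beta borel_prod[symmetric] by measurable
    qed
    have "\<exists>h\<in>borel_measurable borel. AE w in P. R w = h (fst w, T (snd w))"
      by (rule bexI[OF _ h]) (simp add: R_def)
    moreover have "AE w in P. cond_exp_given P snd R w = 0"
      by (rule cond_exp_given_eq_zero)
        (use centered_score.real_cond_exp_F\<^sub>x_eH[OF cs, unfolded P M.F\<^sub>x_def] in \<open>simp add: P R_def\<close>)
    moreover have "AE w in P. cond_exp_given P (\<lambda>w. T (snd w)) R w = 0"
      by (rule cond_exp_given_eq_zero)
        (use centered_score.real_cond_exp_F\<^sub>u_eH[OF cs, unfolded P M.F\<^sub>u_def] in \<open>simp add: P R_def\<close>)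
    ultimately show ?thesis
      using R_H unfolding tangent2_def T_eq by (simp add: split_beta')
  qed
  moreover have "(\<lambda>_. 0) \<in> tangent1 P"
    by (auto simp: tangent1_def hilbert_space_def intro!: bexI[of _ "\<lambda>_. 0"])
  ultimately have R_nuis: "R \<in> nuisance_tangent P B"
    unfolding nuisance_tangent_def by force
  have "is_projection P (score eta1 eta2 Bl) (orth_compl P (nuisance_tangent P B)) s"
  proof -
    have "cov_inner P (\<lambda>w. score eta1 eta2 Bl w - s w) g = 0"
      if g: "g \<in> orth_compl P (nuisance_tangent P B)" for g
    proof -
      \<comment> \<open>What the projection removes is \<open>R\<close> up to a null set, an element
        of the nuisance tangent space and so orthogonal to its whole complement.\<close>
      have "AE w in P. score eta1 eta2 Bl w - s w = R w"
        using S_eq by eventually_elim (simp add: s_def)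
      then have "cov_inner P (\<lambda>w. score eta1 eta2 Bl w - s w) g = cov_inner P R g"
        using g by (intro cov_inner_cong_AE(1)[OF compl]) (auto simp: orth_compl_def intro!: H_meas hilbert_space_diff prob S_H s_H)
      then show ?thesis using g R_nuis by (simp add: orth_compl_def)
    qed
    then show ?thesis using S_H s_orth by (simp add: is_projection_def)
  qed
  \<comment> \<open>Almost sure uniqueness of the projection reduces the theorem to identifying
    \<open>s\<close> with the stated formula.\<close>
  note iff = is_projection_orth_compl_iff[OF compl prob nuisance_tangent_subset_hilbert_space[OF prob] this]

  \<comment> \<open>Comparison with the closed formula\<close>
  have formula: "AE w in P. s w =
      vecl (outer (snd w - cond_exp_given P (\<lambda>(y, x). T x) snd w)
                  (gradient (\<lambda>u. ln (eta2 (fst w) u)) (T (snd w))))"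
    using pos diff
  proof eventually_elim
    case (elim w)
    then obtain D where D: "(eta2 (fst w) has_derivative D) (at (T (snd w)))"
      by (auto simp: differentiable_def)
    have "cond_exp_given P (\<lambda>(y, x). T x) snd w $ Inr l = e l (T (snd w))" for l
      using e[of l w] by (simp add: cond_exp_given_def M.F\<^sub>u_def P split_beta')
    moreover have "gradient (\<lambda>u. ln (eta2 (fst w) u)) (T (snd w)) $ j = G j (fst w, T (snd w))" for j
      using gradient_ln[of eta2 "fst w" D "T (snd w)" j] D elim by (simp add: G_def)
    ultimately show ?case
      by (simp add: vec_eq_iff s_def SG_def R_def vecl_def outer_def left_diff_distrib)
  qed
  show ?thesis
    unfolding iff T_eq
  proof
    assume "AE w in P. S_eff w = s w"
    then have "AE w in P. S_eff w =
      vecl (outer (snd w - cond_exp_given P (\<lambda>(y, x). T x) snd w)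
                  (gradient (\<lambda>u. ln (eta2 (fst w) u)) (T (snd w))))"
      using formula by eventually_elim simp
    then show "AE (y, x) in P. S_eff (y, x) =
       vecl (outer (x - cond_exp_given P (\<lambda>(y, x). T x) snd (y, x))
                   (gradient (\<lambda>u. ln (eta2 y u)) (T x)))"
      by (simp add: split_beta')
  next
    assume "AE (y, x) in P. S_eff (y, x) =
       vecl (outer (x - cond_exp_given P (\<lambda>(y, x). T x) snd (y, x))
                   (gradient (\<lambda>u. ln (eta2 y u)) (T x)))"
    then have "AE w in P. S_eff w =
      vecl (outer (snd w - cond_exp_given P (\<lambda>(y, x). T x) snd w)
                  (gradient (\<lambda>u. ln (eta2 (fst w) u)) (T (snd w))))"
      by (simp add: split_beta')
    then show "AE w in P. S_eff w = s w"
      using formula by eventually_elim simp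
  qed
qed

end
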